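(* Let $\alpha\in[0,2]$. For all $f,g\in\operatorname{dom}\mathfrak t_\alpha$ the limit $$\mathfrak t_\alpha[f,g]:=\lim_{k\to\infty}\int_{-k}^{k}f\,\overline g\,r\,dx$$ exists, and the space $\operatorname{dom}\mathfrak t_\alpha$ is a Krein space with the indefinite inner product $\mathfrak t_\alpha[\cdot,\cdot]$. A fundamental decomposition is given by $$\operatorname{dom}\mathfrak t_\alpha=\overline{\mathcal M_\alpha^+}\oplus\overline{\mathcal M_\alpha^-}$$ (closures in $(\operatorname{dom}\mathfrak t_\alpha,\mathfrak t_\alpha(\cdot,\cdot))$), and $\mathfrak t_\alpha(\cdot,\cdot)$ is the corresponding Hilbert space inner product.
   Context: Let the real function $r\in L^1_{loc}(\mathbb R)$ be odd ($r(-x)=-r(x)$ a.e.) and satisfy, for some $\varepsilon>0$, $r(x)=0$ a.e. on $[-\varepsilon,\varepsilon]$ and $x\,r(x)>0$ a.e. on $(-\infty,-\varepsilon)\cup(\varepsilon,\infty)$. Put $r_-(x):=\frac1x r(x)$. For a weight $w$, $L^2_w(\mathbb R)$ is the space of (classes of) complex measurable $f$ with $\int|f|^2|w|\,dx<\infty$; for a weight $w\ge0$ put $(f,g)_w:=\int_{-\infty}^\infty f\overline g\,w\,dx$. For $\alpha\in[0,2]$ put $$\eta_\alpha(x):=(\sqrt{|x|^\alpha+1}-\sqrt{|x|^\alpha})\,|r(x)|,\qquad\omega_\alpha(x):=\sqrt{|x|^\alpha}\,|r(x)|.$$ For a function $f$ let $f_e(x)=\frac12(f(x)+f(-x))$ and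 $f_o(x)=\frac12(f(x)-f(-x))$. Put $$\operatorname{dom}\mathfrak t_\alpha:=\{f\in L^2_{r_-}(\mathbb R)\,|\,f_e\in L^2_{\eta_\alpha}(\mathbb R),\ f_o\in L^2_{\omega_\alpha}(\mathbb R)\},$$ $$\mathfrak t_\alpha(f,g):=2(f_o,g_o)_{\omega_\alpha}+(f,g)_{\eta_\alpha}\quad(f,g\in\operatorname{dom}\mathfrak t_\alpha),$$ which makes $\operatorname{dom}\mathfrak t_\alpha$ a Hilbert space. Let $$L^2_{r,0}:=\{f\in L^2_r(\mathbb R)\,|\,f(x)=0\text{ a.e. on }\mathbb R\setminus[-k,k]\text{ for some }k>0\}\subset\operatorname{dom}\mathfrak t_\alpha,$$ and on $L^2_{r,0}$ define $(S_\alpha f)(x):=\operatorname{sgn}(x)\big(\sqrt{|x|^\alpha+1}\,f(x)-\sqrt{|x|^\alpha}\,f(-x)\big)$, an operator from $L^2_{r,0}$ into itself. Let $\mathcal M_\alpha^+:=\ker(I-S_\alpha)$ and $\mathcal M_\alpha^-:=\ker(I+S_\alpha)$ (subspaces of $L^2_{r,0}$). $(K,[\cdot,\cdot])$ is a Krein space if $K=K^+\oplus K^-$ (direct, $[\cdot,\cdot]$-orthogonal; a fundamental decomposition) with $(K^+,[\cdot,\cdot])$ and $(K^-,-[\cdot,\cdot])$ Hilbert spaces. The corresponding Hilbert space inner product is $[J\cdot,\cdot]$ with $J=P^+-P^-$, $P^\pm$ the projections onto $K^\pm$. *)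

theory Defs
  imports "HOL-Analysis.Analysis" "HOL-Algebra.Module" "HOL-Algebra.AbelCoset"
    "HOL-Algebra.Algebraic_Closure_Type"
begin

section \<open>Hilbert and Krein spaces on an explicit carrier\<close>

abbreviation complex_ring :: "complex ring"
  where "complex_ring \<equiv> ring_of_type_algebra"

definition hermitian_form ::
    "(complex, 'a) module \<Rightarrow> ('a \<Rightarrow> 'a \<Rightarrow> complex) \<Rightarrow> bool"
  where "hermitian_form V h \<longleftrightarrow>
    (\<forall>x\<in>carrier V. \<forall>y\<in>carrier V. \<forall>z\<in>carrier V. h (x \<oplus>\<^bsub>V\<^esub> y) z = h x z + h y z) \<and>
    (\<forall>c. \<forall>x\<in>carrier V. \<forall>y\<in>carrier V. h (c \<odot>\<^bsub>V\<^esub> x) y = c * h x y) \<and>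
    (\<forall>x\<in>carrier V. \<forall>y\<in>carrier V. h y x = cnj (h x y))"

text \<open>The value 0 off the carrier is only there because \<^locale>\<open>Metric_space\<close>
  asks for a function that is nonnegative and symmetric on the whole type.\<close>

definition ip_dist ::
    "(complex, 'a) module \<Rightarrow> ('a \<Rightarrow> 'a \<Rightarrow> complex) \<Rightarrow> 'a \<Rightarrow> 'a \<Rightarrow> real"
  where "ip_dist V h x y =
    (if x \<in> carrier V \<and> y \<in> carrier V
     then sqrt (Re (h (x \<ominus>\<^bsub>V\<^esub> y) (x \<ominus>\<^bsub>V\<^esub> y))) else 0)"

definition ip_closure ::
    "(complex, 'a) module \<Rightarrow> ('a \<Rightarrow> 'a \<Rightarrow> complex) \<Rightarrow> 'a set \<Rightarrow> 'a set"
  where "ip_closure V h A = Metric_space.mtopology (carrier V) (ip_dist V h) closure_of A"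

definition hilbert_space ::
    "(complex, 'a) module \<Rightarrow> ('a \<Rightarrow> 'a \<Rightarrow> complex) \<Rightarrow> bool"
  where "hilbert_space V h \<longleftrightarrow>
    module complex_ring V \<and> hermitian_form V h \<and>
    (\<forall>x\<in>carrier V. x \<noteq> \<zero>\<^bsub>V\<^esub> \<longrightarrow> 0 < Re (h x x)) \<and>
    Metric_space.mcomplete (carrier V) (ip_dist V h)"

definition fundamental_decomposition ::
    "(complex, 'a) module \<Rightarrow> ('a \<Rightarrow> 'a \<Rightarrow> complex) \<Rightarrow> 'a set \<Rightarrow> 'a set \<Rightarrow> bool"
  where "fundamental_decomposition V h P N \<longleftrightarrow>
    submodule P complex_ring V \<and> submodule N complex_ring V \<and>
    carrier V = P <+>\<^bsub>V\<^esub> N \<and> P \<inter> N = {\<zero>\<^bsub>V\<^esub>} \<and>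
    (\<forall>p\<in>P. \<forall>n\<in>N. h p n = 0) \<and>
    hilbert_space (V\<lparr>carrier := P\<rparr>) h \<and>
    hilbert_space (V\<lparr>carrier := N\<rparr>) (\<lambda>x y. - h x y)"

definition krein_space ::
    "(complex, 'a) module \<Rightarrow> ('a \<Rightarrow> 'a \<Rightarrow> complex) \<Rightarrow> bool"
  where "krein_space V h \<longleftrightarrow>
    module complex_ring V \<and> hermitian_form V h \<and>
    (\<exists>P N. fundamental_decomposition V h P N)"

definition proj_along ::
    "(complex, 'a) module \<Rightarrow> 'a set \<Rightarrow> 'a set \<Rightarrow> 'a \<Rightarrow> 'a"
  where "proj_along V P N x = (THE p. p \<in> P \<and> (\<exists>n\<in>N. x = p \<oplus>\<^bsub>V\<^esub> n))"

definition fundamental_symmetry ::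
    "(complex, 'a) module \<Rightarrow> 'a set \<Rightarrow> 'a set \<Rightarrow> 'a \<Rightarrow> 'a"
  where "fundamental_symmetry V P N x = proj_along V P N x \<ominus>\<^bsub>V\<^esub> proj_along V N P x"

section \<open>Weighted square integrable functions\<close>

definition locally_integrable :: "(real \<Rightarrow> real) \<Rightarrow> bool"
  where "locally_integrable r \<longleftrightarrow> (\<forall>K. compact K \<longrightarrow> set_integrable lebesgue K r)"

definition L2_weight :: "(real \<Rightarrow> real) \<Rightarrow> (real \<Rightarrow> complex) set"
  where "L2_weight w = {f \<in> borel_measurable lebesgue.
    integrable lebesgue (\<lambda>x. (cmod (f x))\<^sup>2 * \<bar>w x\<bar>)}"

definition weight_ip ::
    "(real \<Rightarrow> real) \<Rightarrow> (real \<Rightarrow> complex) \<Rightarrow> (real \<Rightarrow> complex) \<Rightarrow> complex"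
  where "weight_ip w f g = (LINT x|lebesgue. f x * cnj (g x) * complex_of_real (w x))"

definition even_part :: "(real \<Rightarrow> complex) \<Rightarrow> real \<Rightarrow> complex"
  where "even_part f x = (f x + f (- x)) / 2"

definition odd_part :: "(real \<Rightarrow> complex) \<Rightarrow> real \<Rightarrow> complex"
  where "odd_part f x = (f x - f (- x)) / 2"

text \<open>All weights below are \<open>r x\<close> or \<open>\<bar>r x\<bar>\<close> times a factor that is nonzero
  for \<open>x \<noteq> 0\<close>. So they have the same null functions, and one relation,
  equality almost everywhere with respect to \<open>\<bar>r x\<bar> dx\<close>, forms the classes of all the
  spaces involved. Note that \<open>r\<close> vanishes near 0, so this is coarser than Lebesgue
  almost everywhere equality.\<close>

definition ae_eq :: "(real \<Rightarrow> real) \<Rightarrow> ((real \<Rightarrow> complex) \<times> (real \<Rightarrow> complex)) set"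
  where "ae_eq r = {(f, g). f \<in> borel_measurable lebesgue \<and> g \<in> borel_measurable lebesgue \<and>
    (AE x in density lebesgue (\<lambda>x. ennreal \<bar>r x\<bar>). f x = g x)}"

definition ae_class :: "(real \<Rightarrow> real) \<Rightarrow> (real \<Rightarrow> complex) \<Rightarrow> (real \<Rightarrow> complex) set"
  where "ae_class r f = ae_eq r `` {f}"

definition rep :: "(real \<Rightarrow> complex) set \<Rightarrow> real \<Rightarrow> complex"
  where "rep F = (SOME f. f \<in> F)"

text \<open>The vector space of classes of the functions in \<open>D\<close>. The ring multiplication and unit
  of the record play no role in a module. Operations and forms on classes are computed on
  representatives; for the odd \<open>r\<close> considered, the choice of \<open>rep\<close> does not affect them.\<close>

definition class_space ::
    "(real \<Rightarrow> real) \<Rightarrow> (real \<Rightarrow> complex) set \<Rightarrow> (complex, (real \<Rightarrow> complex) set) module"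
  where "class_space r D =
    \<lparr>carrier = D // ae_eq r,
     mult = (\<lambda>F G. undefined), one = undefined,
     zero = ae_class r (\<lambda>x. 0),
     add = (\<lambda>F G. ae_class r (\<lambda>x. rep F x + rep G x)),
     smult = (\<lambda>c F. ae_class r (\<lambda>x. c * rep F x))\<rparr>"

lemma equiv_ae_eq: "equiv (borel_measurable lebesgue) (ae_eq r)"
proof (rule equivI)
  show "ae_eq r \<subseteq> borel_measurable lebesgue \<times> borel_measurable lebesgue"
    by (auto simp: ae_eq_def)
  show "refl_on (borel_measurable lebesgue) (ae_eq r)"
    by (auto simp: refl_on_def ae_eq_def)
  show "sym (ae_eq r)"
    by (auto simp: sym_def ae_eq_def elim: eventually_mono)
  show "trans (ae_eq r)"
    by (auto simp: trans_def ae_eq_def elim: eventually_elim2)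
qed

section \<open>The forms\<close>

definition r_minus :: "(real \<Rightarrow> real) \<Rightarrow> real \<Rightarrow> real"
  where "r_minus r x = 1 / x * r x"

definition eta :: "(real \<Rightarrow> real) \<Rightarrow> real \<Rightarrow> real \<Rightarrow> real"
  where "eta r \<alpha> x = (sqrt (\<bar>x\<bar> powr \<alpha> + 1) - sqrt (\<bar>x\<bar> powr \<alpha>)) * \<bar>r x\<bar>"

definition omega :: "(real \<Rightarrow> real) \<Rightarrow> real \<Rightarrow> real \<Rightarrow> real"
  where "omega r \<alpha> x = sqrt (\<bar>x\<bar> powr \<alpha>) * \<bar>r x\<bar>"

definition dom_t_fun :: "(real \<Rightarrow> real) \<Rightarrow> real \<Rightarrow> (real \<Rightarrow> complex) set"
  where "dom_t_fun r \<alpha> = {f \<in> L2_weight (r_minus r).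
    even_part f \<in> L2_weight (eta r \<alpha>) \<and> odd_part f \<in> L2_weight (omega r \<alpha>)}"

definition t_fun ::
    "(real \<Rightarrow> real) \<Rightarrow> real \<Rightarrow> (real \<Rightarrow> complex) \<Rightarrow> (real \<Rightarrow> complex) \<Rightarrow> complex"
  where "t_fun r \<alpha> f g =
    2 * weight_ip (omega r \<alpha>) (odd_part f) (odd_part g) + weight_ip (eta r \<alpha>) f g"

definition t_indef_fun ::
    "(real \<Rightarrow> real) \<Rightarrow> (real \<Rightarrow> complex) \<Rightarrow> (real \<Rightarrow> complex) \<Rightarrow> complex"
  where "t_indef_fun r f g =
    Lim at_top (\<lambda>k. LINT x:{-k..k}|lebesgue. f x * cnj (g x) * complex_of_real (r x))"

definition dom_t :: "(real \<Rightarrow> real) \<Rightarrow> real \<Rightarrow> (complex, (real \<Rightarrow> complex) set) module"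
  where "dom_t r \<alpha> = class_space r (dom_t_fun r \<alpha>)"

definition t_form ::
    "(real \<Rightarrow> real) \<Rightarrow> real \<Rightarrow> (real \<Rightarrow> complex) set \<Rightarrow> (real \<Rightarrow> complex) set \<Rightarrow> complex"
  where "t_form r \<alpha> F G = t_fun r \<alpha> (rep F) (rep G)"

definition t_indef ::
    "(real \<Rightarrow> real) \<Rightarrow> (real \<Rightarrow> complex) set \<Rightarrow> (real \<Rightarrow> complex) set \<Rightarrow> complex"
  where "t_indef r F G = t_indef_fun r (rep F) (rep G)"

definition L2_r0_fun :: "(real \<Rightarrow> real) \<Rightarrow> (real \<Rightarrow> complex) set"
  where "L2_r0_fun r = {f \<in> L2_weight r.
    \<exists>k>0. AE x in lebesgue. x \<in> UNIV - {-k..k} \<longrightarrow> f x = 0}"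

definition L2_r0 :: "(real \<Rightarrow> real) \<Rightarrow> (complex, (real \<Rightarrow> complex) set) module"
  where "L2_r0 r = class_space r (L2_r0_fun r)"

definition S_fun :: "real \<Rightarrow> (real \<Rightarrow> complex) \<Rightarrow> real \<Rightarrow> complex"
  where "S_fun \<alpha> f x = complex_of_real (sgn x) *
    (complex_of_real (sqrt (\<bar>x\<bar> powr \<alpha> + 1)) * f x -
     complex_of_real (sqrt (\<bar>x\<bar> powr \<alpha>)) * f (- x))"

definition S_op ::
    "(real \<Rightarrow> real) \<Rightarrow> real \<Rightarrow> (real \<Rightarrow> complex) set \<Rightarrow> (real \<Rightarrow> complex) set"
  where "S_op r \<alpha> F = ae_class r (S_fun \<alpha> (rep F))"

definition M_plus :: "(real \<Rightarrow> real) \<Rightarrow> real \<Rightarrow> (real \<Rightarrow> complex) set set"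
  where "M_plus r \<alpha> =
    {F \<in> carrier (L2_r0 r). F \<ominus>\<^bsub>L2_r0 r\<^esub> S_op r \<alpha> F = \<zero>\<^bsub>L2_r0 r\<^esub>}"

definition M_minus :: "(real \<Rightarrow> real) \<Rightarrow> real \<Rightarrow> (real \<Rightarrow> complex) set set"
  where "M_minus r \<alpha> =
    {F \<in> carrier (L2_r0 r). F \<oplus>\<^bsub>L2_r0 r\<^esub> S_op r \<alpha> F = \<zero>\<^bsub>L2_r0 r\<^esub>}"

end

theory Submission
  imports Defs
begin

text \<open>
  Let \<open>a = sqrt (\<bar>x\<bar> powr \<alpha> + 1)\<close> and \<open>b = sqrt (\<bar>x\<bar> powr \<alpha>)\<close>. Since \<open>a\<^sup>2 - b\<^sup>2 = 1\<close>, the even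
  functions \<open>a - b\<close> and \<open>a + b\<close> are reciprocal; let \<open>s\<close> be the square root of \<open>a - b\<close>. Split
  functions into even and odd parts. In the inner product \<open>t_fun\<close> the mixed terms cancel, and the
  even parts carry the weight \<open>s\<^sup>2 * \<bar>r x\<bar>\<close>, the odd parts the weight \<open>\<bar>r x\<bar> / s\<^sup>2\<close>. In the integral
  of \<open>f * cnj g * r\<close> over \<open>{-k..k}\<close>, the weight is odd and only the mixed terms survive.
  Therefore the map
  \<open>\<Phi> f = s * even_part f + odd_part f / s\<close> turns \<open>t_fun\<close> into the inner product with weight
  \<open>\<bar>r x\<bar>\<close> (\<open>t_fun_eq\<close>) and leaves the integrals over \<open>{-k..k}\<close> unchanged
  (\<open>truncated_integral_eq\<close>).

  For \<open>\<bar>x\<bar> > \<epsilon>\<close> and \<open>0 \<le> \<alpha> \<le> 2\<close>, the function \<open>a + b\<close> is bounded by multiples of \<open>b\<close> and of \<open>\<bar>x\<bar>\<close>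
  (\<open>growth_bounds\<close>). These bounds say that the form domain consists of all \<open>f\<close> for which \<open>\<Phi> f\<close> is
  square integrable with weight \<open>\<bar>r x\<bar>\<close> (\<open>dom_t_fun_iff\<close>). So \<open>\<Phi>\<close> is a unitary map onto a
  weighted L2 space, under which the indefinite form becomes the absolutely convergent integral
  of \<open>f * cnj g * r\<close> (\<open>t_indef_fun_eq\<close>), and \<open>S_fun \<alpha>\<close> becomes multiplication by \<open>sgn x\<close>
  (\<open>\<Phi>_S\<close>). The claim is thus carried over from the best known Krein space: there the fundamental
  symmetry is multiplication by the sign of the weight, and the fundamental decomposition splits a
  function into its restrictions to the two half-lines.

  The general reason why that is a Krein space is \<open>fundamental_decomposition_fixed\<close>: for a
  self-adjoint linear involution \<open>S\<close> of a Hilbert space, the form \<open>h (S x) y\<close> has the fixed and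
  the antifixed vectors of \<open>S\<close> as a fundamental decomposition, with fundamental symmetry \<open>S\<close>.
  Completeness is the theorem of Riesz and Fischer (\<open>riesz_fischer\<close>). Finally, \<open>M_plus\<close> and
  \<open>M_minus\<close> are the fixed and the antifixed vectors with bounded support. Cutting a function off
  outside \<open>{-k..k}\<close> commutes with \<open>S_fun \<alpha>\<close> and converges in the form domain, so they are dense in
  all fixed and in all antifixed vectors (\<open>closure_M_plus\<close>, \<open>closure_M_minus\<close>).
\<close>

section \<open>Inner products on modules\<close>

lemma complex_ring_simps [simp]:
  "carrier complex_ring = UNIV" "a \<oplus>\<^bsub>complex_ring\<^esub> b = a + b"
  "a \<otimes>\<^bsub>complex_ring\<^esub> b = a * b" "\<one>\<^bsub>complex_ring\<^esub> = 1" "\<zero>\<^bsub>complex_ring\<^esub> = 0"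
  by (simp_all add: ring_of_type_algebra_def)

lemma a_inv_complex_ring [simp]: "\<ominus>\<^bsub>complex_ring\<^esub> a = - a"
proof -
  interpret cring complex_ring by (rule cring_from_type_algebra)
  have "\<ominus>\<^bsub>complex_ring\<^esub> a \<oplus>\<^bsub>complex_ring\<^esub> a = \<zero>\<^bsub>complex_ring\<^esub>" by (intro l_neg) simp
  then show ?thesis by (simp add: eq_neg_iff_add_eq_0)
qed

lemma (in abelian_group) diff_eq_zero_iff:
  assumes x: "x \<in> carrier G" and y: "y \<in> carrier G"
  shows "x \<ominus> y = \<zero> \<longleftrightarrow> x = y"
proof
  assume "x \<ominus> y = \<zero>"
  then have "\<ominus> (\<ominus> y) = x" using x y by (intro minus_equality) (auto simp: a_minus_def)
  then show "x = y" using y by simp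
qed (use y in \<open>simp add: a_minus_def r_neg\<close>)

locale ip_module = module complex_ring V for V :: "(complex, 'a) module" (structure) +
  fixes h :: "'a \<Rightarrow> 'a \<Rightarrow> complex"
  assumes hermitian: "hermitian_form V h"
    and pos: "x \<in> carrier V \<Longrightarrow> x \<noteq> \<zero> \<Longrightarrow> 0 < Re (h x x)"
begin

lemma ip_add_left: "x \<in> carrier V \<Longrightarrow> y \<in> carrier V \<Longrightarrow> z \<in> carrier V \<Longrightarrow> h (x \<oplus> y) z = h x z + h y z"
  and ip_smult_left: "x \<in> carrier V \<Longrightarrow> y \<in> carrier V \<Longrightarrow> h (c \<odot> x) y = c * h x y"
  and ip_sym: "x \<in> carrier V \<Longrightarrow> y \<in> carrier V \<Longrightarrow> h y x = cnj (h x y)"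
  using hermitian unfolding hermitian_form_def by blast+

lemma smult_zero_left: "x \<in> carrier V \<Longrightarrow> 0 \<odot> x = \<zero>"
  using smult_l_null[of x] by simp

lemma uminus_eq_smult: "x \<in> carrier V \<Longrightarrow> \<ominus> x = (-1) \<odot> x"
  using smult_l_minus[of 1 x] smult_one[of x] by simp

lemma ip_zero_left [simp]: "y \<in> carrier V \<Longrightarrow> h \<zero> y = 0"
  using ip_smult_left[of \<zero> y 0] smult_zero_left[of \<zero>] by simp

lemma ip_uminus_left: "x \<in> carrier V \<Longrightarrow> y \<in> carrier V \<Longrightarrow> h (\<ominus> x) y = - h x y"
  by (simp add: uminus_eq_smult ip_smult_left)

lemma ip_diff_left: "x \<in> carrier V \<Longrightarrow> y \<in> carrier V \<Longrightarrow> z \<in> carrier V \<Longrightarrow> h (x \<ominus> y) z = h x z - h y z"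
  by (simp add: a_minus_def ip_add_left ip_uminus_left)

lemma ip_add_right: "x \<in> carrier V \<Longrightarrow> y \<in> carrier V \<Longrightarrow> z \<in> carrier V \<Longrightarrow> h z (x \<oplus> y) = h z x + h z y"
  using ip_sym[of "x \<oplus> y" z] ip_sym[of x z] ip_sym[of y z] by (simp add: ip_add_left)

lemma ip_smult_right: "x \<in> carrier V \<Longrightarrow> y \<in> carrier V \<Longrightarrow> h y (c \<odot> x) = cnj c * h y x"
  using ip_sym[of "c \<odot> x" y] ip_sym[of x y] by (simp add: ip_smult_left)

lemma ip_uminus_right: "x \<in> carrier V \<Longrightarrow> y \<in> carrier V \<Longrightarrow> h y (\<ominus> x) = - h y x"
  using ip_sym[of "\<ominus> x" y] ip_sym[of x y] by (simp add: ip_uminus_left)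

lemma ip_diff_right: "x \<in> carrier V \<Longrightarrow> y \<in> carrier V \<Longrightarrow> z \<in> carrier V \<Longrightarrow> h z (x \<ominus> y) = h z x - h z y"
  by (simp add: a_minus_def ip_add_right ip_uminus_right)

lemma ip_self_ge_0: "x \<in> carrier V \<Longrightarrow> 0 \<le> Re (h x x)"
  using pos[of x] by (cases "x = \<zero>") auto

lemma ip_self_eq_0_iff: "x \<in> carrier V \<Longrightarrow> Re (h x x) = 0 \<longleftrightarrow> x = \<zero>"
  using pos[of x] by (cases "x = \<zero>") auto

lemma ip_self_real: "x \<in> carrier V \<Longrightarrow> h x x = complex_of_real (Re (h x x))"
  using arg_cong[OF ip_sym[of x x], of Im] by (simp add: complex_eq_iff)

text \<open>Expand \<open>0 \<le> h (x - c y) (x - c y)\<close> for the real \<open>c\<close> that minimises it. A real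
  \<open>c\<close> sees only the real part of \<open>h x y\<close>, which is the part that enters the triangle inequality.\<close>

lemma cauchy_schwarz:
  assumes x: "x \<in> carrier V" and y: "y \<in> carrier V"
  shows "Re (h x y) \<le> sqrt (Re (h x x)) * sqrt (Re (h y y))"
proof (cases "y = \<zero>")
  case True
  then show ?thesis using x ip_sym[of \<zero> x] by (simp add: y)
next
  case False
  define b where "b = Re (h y y)"
  have b: "b > 0" using pos[OF y False] by (simp add: b_def)
  define c where "c = complex_of_real (Re (h x y) / b)"
  have hyy: "h y y = complex_of_real b" using ip_self_real[OF y] by (simp add: b_def)
  have "0 \<le> Re (h (x \<ominus> c \<odot> y) (x \<ominus> c \<odot> y))" using x y by (intro ip_self_ge_0) auto
  also have "h (x \<ominus> c \<odot> y) (x \<ominus> c \<odot> y) = h x x - cnj c * h x y - c * h y x + c * cnj c * h y y"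
    using x y by (simp add: ip_diff_left ip_diff_right ip_smult_left ip_smult_right algebra_simps)
  also have "Re \<dots> = Re (h x x) - (Re (h x y))\<^sup>2 / b"
    using b unfolding hyy ip_sym[OF x y] by (simp add: c_def power2_eq_square field_simps)
  finally have "(Re (h x y))\<^sup>2 \<le> Re (h x x) * b" using b by (simp add: field_simps)
  then have "Re (h x y) \<le> sqrt (Re (h x x) * b)" using real_le_rsqrt by blast
  then show ?thesis by (simp add: b_def real_sqrt_mult)
qed

lemma norm_triangle:
  assumes x: "x \<in> carrier V" and y: "y \<in> carrier V"
  shows "sqrt (Re (h (x \<oplus> y) (x \<oplus> y))) \<le> sqrt (Re (h x x)) + sqrt (Re (h y y))"
proof (rule real_le_lsqrt)
  have "Re (h (x \<oplus> y) (x \<oplus> y)) = Re (h x x) + 2 * Re (h x y) + Re (h y y)"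
    using x y ip_sym[OF x y] by (simp add: ip_add_left ip_add_right)
  also have "\<dots> \<le> (sqrt (Re (h x x)) + sqrt (Re (h y y)))\<^sup>2"
    using cauchy_schwarz[OF x y] ip_self_ge_0[OF x] ip_self_ge_0[OF y] by (simp add: power2_sum)
  finally show "Re (h (x \<oplus> y) (x \<oplus> y)) \<le> (sqrt (Re (h x x)) + sqrt (Re (h y y)))\<^sup>2" .
qed (use x y ip_self_ge_0 in auto)

lemma ip_dist_eq: "x \<in> carrier V \<Longrightarrow> y \<in> carrier V \<Longrightarrow> ip_dist V h x y = sqrt (Re (h (x \<ominus> y) (x \<ominus> y)))"
  by (simp add: ip_dist_def)

lemma diff_add_diff: "x \<in> carrier V \<Longrightarrow> y \<in> carrier V \<Longrightarrow> z \<in> carrier V \<Longrightarrow> (x \<ominus> y) \<oplus> (y \<ominus> z) = x \<ominus> z"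
  by (simp add: a_minus_def a_assoc r_neg1)

sublocale ip: Metric_space "carrier V" "ip_dist V h"
proof
  show "0 \<le> ip_dist V h x y" for x y by (simp add: ip_dist_def ip_self_ge_0)
  have "h (x \<ominus> y) (x \<ominus> y) = h (y \<ominus> x) (y \<ominus> x)" if "x \<in> carrier V" "y \<in> carrier V" for x y
    using that by (simp add: ip_diff_left ip_diff_right)
  then show "ip_dist V h x y = ip_dist V h y x" for x y by (simp add: ip_dist_def)
  show "ip_dist V h x y = 0 \<longleftrightarrow> x = y" if "x \<in> carrier V" "y \<in> carrier V" for x y
    using that by (simp add: ip_dist_eq ip_self_eq_0_iff diff_eq_zero_iff)
  show "ip_dist V h x z \<le> ip_dist V h x y + ip_dist V h y z"
    if "x \<in> carrier V" "y \<in> carrier V" "z \<in> carrier V" for x y z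
    using that norm_triangle[of "x \<ominus> y" "y \<ominus> z"] by (simp add: ip_dist_eq diff_add_diff)
qed

lemma mem_ip_closure_iff:
  "x \<in> ip_closure V h A \<longleftrightarrow> x \<in> carrier V \<and> (\<forall>e>0. \<exists>y\<in>A. y \<in> carrier V \<and> ip_dist V h x y < e)"
  by (auto simp: ip_closure_def ip.metric_closure_of ip.in_mball)

text \<open>Subtraction refers to an inverse that is chosen in the carrier, so it has to be compared when
  the carrier shrinks.\<close>

lemma submodule_minus:
  assumes W: "submodule W complex_ring V" and x: "x \<in> W" and y: "y \<in> W"
  shows "x \<ominus>\<^bsub>V\<lparr>carrier := W\<rparr>\<^esub> y = x \<ominus> y"
proof -
  have "subgroup W (add_monoid V)" using W by (simp add: submodule_def)
  then have "inv\<^bsub>(add_monoid V)\<lparr>carrier := W\<rparr>\<^esub> y = inv\<^bsub>add_monoid V\<^esub> y"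
    using group.m_inv_consistent[OF a_group _ y] by simp
  then show ?thesis by (simp add: a_minus_def a_inv_def)
qed

lemma hilbert_space_closed_submodule:
  assumes W: "submodule W complex_ring V" and closed: "ip_closure V h W \<subseteq> W"
    and complete: "Metric_space.mcomplete (carrier V) (ip_dist V h)"
    and eq: "\<And>x y. x \<in> W \<Longrightarrow> y \<in> W \<Longrightarrow> k x y = h x y"
  shows "hilbert_space (V\<lparr>carrier := W\<rparr>) k"
proof -
  let ?W = "V\<lparr>carrier := W\<rparr>"
  have sub: "W \<subseteq> carrier V" and add: "\<And>x y. x \<in> W \<Longrightarrow> y \<in> W \<Longrightarrow> x \<oplus> y \<in> W"
    and smult: "\<And>c x. x \<in> W \<Longrightarrow> c \<odot> x \<in> W"
    using submoduleE[OF W] by auto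
  have diff: "x \<ominus> y \<in> W" if "x \<in> W" "y \<in> W" for x y
    using that add submoduleE(3)[OF W] by (simp add: a_minus_def)
  have mod: "module complex_ring ?W"
    by (rule submodule.submodule_is_module[OF W]) (rule module_axioms)
  have herm: "hermitian_form ?W k"
    unfolding hermitian_form_def
    using sub add smult by (auto simp: eq ip_add_left ip_smult_left subset_iff intro: ip_sym)
  have p: "0 < Re (k x x)" if "x \<in> W" "x \<noteq> \<zero>" for x using that sub pos eq by auto
  interpret W: ip_module ?W k
    by (intro ip_module.intro ip_module_axioms.intro mod herm) (use p in auto)
  have d: "ip_dist ?W k x y = ip_dist V h x y" if "x \<in> W" "y \<in> W" for x y
    using that sub diff by (auto simp: ip_dist_def submodule_minus[OF W] eq)
  have "W.ip.mcomplete"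
    unfolding W.ip.mcomplete_def
  proof (intro allI impI)
    fix \<sigma> assume \<sigma>: "W.ip.MCauchy \<sigma>"
    then have \<sigma>W: "\<sigma> n \<in> W" for n unfolding W.ip.MCauchy_def by auto
    then have "ip.MCauchy \<sigma>"
      using \<sigma> sub d[OF \<sigma>W \<sigma>W] unfolding W.ip.MCauchy_def ip.MCauchy_def by auto
    then obtain x where x: "limitin ip.mtopology \<sigma> x sequentially"
      using complete ip.mcomplete_def by blast
    have "x \<in> ip_closure V h W"
      unfolding mem_ip_closure_iff
      using x \<sigma>W sub unfolding ip.limit_metric_sequentially
      by (metis ip.commute order_refl)
    then have xW: "x \<in> W" using closed by auto
    have "limitin W.ip.mtopology \<sigma> x sequentially"
      using x xW \<sigma>W d[OF \<sigma>W xW]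
      unfolding W.ip.limit_metric_sequentially ip.limit_metric_sequentially by simp meson
    then show "\<exists>x. limitin W.ip.mtopology \<sigma> x sequentially" ..
  qed
  then show ?thesis using mod herm p by (simp add: hilbert_space_def)
qed

end

section \<open>Krein spaces from self-adjoint involutions\<close>

locale selfadjoint_involution = ip_module +
  fixes S :: "'a \<Rightarrow> 'a"
  assumes S_closed [simp]: "x \<in> carrier V \<Longrightarrow> S x \<in> carrier V"
    and S_add: "x \<in> carrier V \<Longrightarrow> y \<in> carrier V \<Longrightarrow> S (x \<oplus> y) = S x \<oplus> S y"
    and S_smult: "x \<in> carrier V \<Longrightarrow> S (c \<odot> x) = c \<odot> S x"
    and S_S [simp]: "x \<in> carrier V \<Longrightarrow> S (S x) = x"
    and S_selfadjoint: "x \<in> carrier V \<Longrightarrow> y \<in> carrier V \<Longrightarrow> h (S x) y = h x (S y)"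
begin

lemma S_uminus: "x \<in> carrier V \<Longrightarrow> S (\<ominus> x) = \<ominus> S x"
  by (simp add: uminus_eq_smult S_smult)

lemma S_diff: "x \<in> carrier V \<Longrightarrow> y \<in> carrier V \<Longrightarrow> S (x \<ominus> y) = S x \<ominus> S y"
  by (simp add: a_minus_def S_add S_uminus)

lemma S_zero: "S \<zero> = \<zero>"
  using S_smult[of \<zero> 0] by (simp add: smult_zero_left)

lemma S_isometry: "x \<in> carrier V \<Longrightarrow> y \<in> carrier V \<Longrightarrow> ip_dist V h (S x) (S y) = ip_dist V h x y"
  using S_selfadjoint[of "x \<ominus> y" "S (x \<ominus> y)"] by (simp add: ip_dist_eq S_diff)

definition fixed :: "'a set"
  where "fixed = {x \<in> carrier V. S x = x}"

lemma submodule_fixed: "submodule fixed complex_ring V"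
  by (rule submoduleI) (auto simp: fixed_def S_add S_smult S_uminus S_zero)

text \<open>The fixed space is closed because \<open>S\<close> is isometric: a vector at distance \<open>d\<close> from a fixed
  vector is moved by at most \<open>2 d\<close>.\<close>

lemma closure_subset_fixed:
  assumes "A \<subseteq> fixed" shows "ip_closure V h A \<subseteq> fixed"
proof
  fix x assume "x \<in> ip_closure V h A"
  then have x: "x \<in> carrier V" and close: "\<And>e. e > 0 \<Longrightarrow> \<exists>y\<in>A. ip_dist V h x y < e"
    by (auto simp: mem_ip_closure_iff)
  have "ip_dist V h (S x) x \<le> 0 + e" if e: "e > 0" for e
  proof -
    obtain y where y: "y \<in> A" "ip_dist V h x y < e / 2" using close[OF half_gt_zero[OF e]] by blast
    then have yV: "y \<in> carrier V" "S y = y" using assms by (auto simp: fixed_def)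
    have "ip_dist V h (S x) x \<le> ip_dist V h (S x) (S y) + ip_dist V h y x"
      using ip.triangle[of "S x" y x] x yV by simp
    also have "\<dots> = 2 * ip_dist V h x y"
      unfolding S_isometry[OF x yV(1)] ip.commute[of y x] by simp
    finally show ?thesis using y by simp
  qed
  then have "ip_dist V h (S x) x \<le> 0" by (rule field_le_epsilon)
  then have "ip_dist V h (S x) x = 0" using ip.nonneg[of "S x" x] by linarith
  then show "x \<in> fixed" using x by (simp add: fixed_def)
qed

text \<open>All facts about fixed vectors of \<open>- S\<close> are facts about antifixed vectors of \<open>S\<close>.\<close>

lemma selfadjoint_involution_uminus: "selfadjoint_involution V h (\<lambda>x. \<ominus> S x)"
  by (unfold_locales)
    (auto simp: S_add S_smult S_uminus minus_add smult_r_minus ip_uminus_left ip_uminus_right S_selfadjoint)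

lemma fixed_uminus: "selfadjoint_involution.fixed V (\<lambda>x. \<ominus> S x) = {x \<in> carrier V. S x = \<ominus> x}"
proof -
  interpret minus: selfadjoint_involution V h "\<lambda>x. \<ominus> S x" by (rule selfadjoint_involution_uminus)
  show ?thesis unfolding minus.fixed_def by (metis (no_types, lifting) S_closed minus_minus)
qed

definition antifixed :: "'a set"
  where "antifixed = {x \<in> carrier V. S x = \<ominus> x}"

lemma closure_subset_antifixed: "A \<subseteq> antifixed \<Longrightarrow> ip_closure V h A \<subseteq> antifixed"
  using selfadjoint_involution.closure_subset_fixed[OF selfadjoint_involution_uminus, unfolded fixed_uminus]
  unfolding antifixed_def .

lemma submodule_antifixed: "submodule antifixed complex_ring V"
  using selfadjoint_involution.submodule_fixed[OF selfadjoint_involution_uminus, unfolded fixed_uminus]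
  unfolding antifixed_def .

lemma add_eq_add_swap:
  assumes "a \<in> carrier V" "b \<in> carrier V" "c \<in> carrier V" "d \<in> carrier V"
  shows "(a \<oplus> b) \<oplus> (c \<oplus> d) = (a \<oplus> c) \<oplus> (b \<oplus> d)"
  using assms by (simp add: a_ac)

lemma half_add_half: "x \<in> carrier V \<Longrightarrow> (1/2) \<odot> (x \<oplus> x) = x"
  using smult_l_distr[of "1/2" "1/2" x] smult_one[of x] by (simp add: smult_r_distr)

lemma half_sum_decomposition:
  assumes x: "x \<in> carrier V"
  shows "(1/2) \<odot> (x \<oplus> S x) \<in> fixed" "(1/2) \<odot> (x \<ominus> S x) \<in> antifixed"
    "x = (1/2) \<odot> (x \<oplus> S x) \<oplus> (1/2) \<odot> (x \<ominus> S x)"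
    "S x = (1/2) \<odot> (x \<oplus> S x) \<ominus> (1/2) \<odot> (x \<ominus> S x)"
proof -
  show "(1/2) \<odot> (x \<oplus> S x) \<in> fixed"
    using x by (simp add: fixed_def S_smult S_add a_comm)
  have m: "\<ominus> (x \<ominus> S x) = S x \<ominus> x" using x by (simp add: a_minus_def minus_add a_comm)
  then show "(1/2) \<odot> (x \<ominus> S x) \<in> antifixed"
    using x smult_r_minus[of "1/2" "x \<ominus> S x"] by (simp add: antifixed_def S_smult S_diff)
  have "(x \<oplus> S x) \<oplus> (x \<ominus> S x) = x \<oplus> x"
    using x by (simp add: a_minus_def add_eq_add_swap r_neg)
  then show "x = (1/2) \<odot> (x \<oplus> S x) \<oplus> (1/2) \<odot> (x \<ominus> S x)"
    using x smult_r_distr[of "1/2" "x \<oplus> S x" "x \<ominus> S x"] half_add_half[OF x] by simp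
  have "(x \<oplus> S x) \<oplus> (S x \<ominus> x) = S x \<oplus> S x"
    using x add_eq_add_swap[of x "S x" "\<ominus> x" "S x"] a_comm[of "S x" "\<ominus> x"]
    by (simp add: a_minus_def r_neg)
  then show "S x = (1/2) \<odot> (x \<oplus> S x) \<ominus> (1/2) \<odot> (x \<ominus> S x)"
    using x smult_r_distr[of "1/2" "x \<oplus> S x" "S x \<ominus> x"] half_add_half[of "S x"]
      smult_r_minus[of "1/2" "x \<ominus> S x"] m
    by (simp add: a_minus_def)
qed

text \<open>Applying \<open>S\<close> to \<open>x = p + n\<close> gives \<open>S x = p - n\<close>, which determines \<open>p\<close> and \<open>n\<close>. So the two
  projections of \<open>x\<close> are the halves of \<open>x + S x\<close> and of \<open>x - S x\<close>, and their difference is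
  \<open>S x\<close>.\<close>

lemma decomposition_unique:
  assumes p: "p \<in> fixed" and n: "n \<in> antifixed" and x: "x = p \<oplus> n"
  shows "(1/2) \<odot> (x \<oplus> S x) = p" "(1/2) \<odot> (x \<ominus> S x) = n"
proof -
  have c: "p \<in> carrier V" "n \<in> carrier V" "S p = p" "S n = \<ominus> n"
    using p n by (auto simp: fixed_def antifixed_def)
  have S: "S x = p \<ominus> n" using c by (simp add: x S_add a_minus_def)
  have "x \<oplus> S x = p \<oplus> p"
    unfolding S using c add_eq_add_swap[of p n p "\<ominus> n"] by (simp add: x a_minus_def r_neg)
  then show "(1/2) \<odot> (x \<oplus> S x) = p" using half_add_half c by simp
  have "x \<ominus> S x = n \<oplus> n"
    unfolding S using c add_eq_add_swap[of p n "\<ominus> p" n] by (simp add: x a_minus_def minus_add r_neg)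
  then show "(1/2) \<odot> (x \<ominus> S x) = n" using half_add_half c by simp
qed

lemma fundamental_symmetry_eq:
  assumes x: "x \<in> carrier V"
  shows "fundamental_symmetry V fixed antifixed x = S x"
proof -
  have comm: "n \<oplus> p = p \<oplus> n" if "p \<in> fixed" "n \<in> antifixed" for p n
    using that by (auto simp: fixed_def antifixed_def a_comm)
  have "proj_along V fixed antifixed x = (1/2) \<odot> (x \<oplus> S x)"
    unfolding proj_along_def
  proof (rule the_equality)
    show "(1/2) \<odot> (x \<oplus> S x) \<in> fixed \<and> (\<exists>n\<in>antifixed. x = (1/2) \<odot> (x \<oplus> S x) \<oplus> n)"
      using half_sum_decomposition(1-3)[OF x] by blast
    show "p = (1/2) \<odot> (x \<oplus> S x)" if "p \<in> fixed \<and> (\<exists>n\<in>antifixed. x = p \<oplus> n)" for p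
      using that by (auto dest!: decomposition_unique(1))
  qed
  moreover have "proj_along V antifixed fixed x = (1/2) \<odot> (x \<ominus> S x)"
    unfolding proj_along_def
  proof (rule the_equality)
    show "(1/2) \<odot> (x \<ominus> S x) \<in> antifixed \<and> (\<exists>n\<in>fixed. x = (1/2) \<odot> (x \<ominus> S x) \<oplus> n)"
      using half_sum_decomposition(1-3)[OF x] comm[OF half_sum_decomposition(1-2)[OF x]]
      by (intro conjI bexI[of _ "(1/2) \<odot> (x \<oplus> S x)"]) simp_all
    show "q = (1/2) \<odot> (x \<ominus> S x)" if q: "q \<in> antifixed \<and> (\<exists>n\<in>fixed. x = q \<oplus> n)" for q
    proof -
      obtain p where p: "p \<in> fixed" "q \<in> antifixed" "x = q \<oplus> p" using q by blast
      then have "x = p \<oplus> q" using comm by simp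
      then show ?thesis using decomposition_unique(2)[OF p(1,2)] by simp
    qed
  qed
  ultimately show ?thesis
    unfolding fundamental_symmetry_def using half_sum_decomposition(4)[OF x] by simp
qed

text \<open>\<open>S\<close> is self-adjoint, and eigenvectors for the different eigenvalues \<open>1\<close> and \<open>-1\<close> are
  orthogonal.\<close>

lemma fixed_orthogonal_antifixed:
  assumes "p \<in> fixed" "n \<in> antifixed"
  shows "h p n = 0"
proof -
  have c: "p \<in> carrier V" "n \<in> carrier V" "S p = p" "S n = \<ominus> n"
    using assms by (auto simp: fixed_def antifixed_def)
  have "h p n = - h p n" using S_selfadjoint[of p n] c by (simp add: ip_uminus_right)
  then show ?thesis by simp
qed

text \<open>On fixed vectors the form \<open>h (S x) y\<close> agrees with the inner product \<open>h\<close>, on antifixed vectors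
  with \<open>- h\<close>. Both spaces are closed in a complete space, hence are Hilbert spaces for these
  forms.\<close>

theorem fundamental_decomposition_fixed:
  assumes complete: "Metric_space.mcomplete (carrier V) (ip_dist V h)"
    and k: "\<And>x y. x \<in> carrier V \<Longrightarrow> y \<in> carrier V \<Longrightarrow> k x y = h (S x) y"
  shows "fundamental_decomposition V k fixed antifixed"
  unfolding fundamental_decomposition_def
proof (intro conjI ballI)
  have sub: "fixed \<subseteq> carrier V" "antifixed \<subseteq> carrier V" by (auto simp: fixed_def antifixed_def)
  show "carrier V = fixed <+>\<^bsub>V\<^esub> antifixed"
  proof
    show "carrier V \<subseteq> fixed <+>\<^bsub>V\<^esub> antifixed"
      unfolding set_add_def' using half_sum_decomposition by blast
    show "fixed <+>\<^bsub>V\<^esub> antifixed \<subseteq> carrier V"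
      unfolding set_add_def' using sub by auto
  qed
  show "fixed \<inter> antifixed = {\<zero>}"
  proof
    show "fixed \<inter> antifixed \<subseteq> {\<zero>}"
    proof
      fix x assume x: "x \<in> fixed \<inter> antifixed"
      then have "h x x = 0" using fixed_orthogonal_antifixed by blast
      then show "x \<in> {\<zero>}" using x sub ip_self_eq_0_iff[of x] by auto
    qed
  qed (auto simp: fixed_def antifixed_def S_zero uminus_eq_smult smult_r_null)
  show "k p n = 0" if "p \<in> fixed" "n \<in> antifixed" for p n
    using that sub fixed_orthogonal_antifixed[OF that] by (simp add: k fixed_def antifixed_def)
  show "hilbert_space (V\<lparr>carrier := fixed\<rparr>) k"
    by (rule hilbert_space_closed_submodule[OF submodule_fixed closure_subset_fixed complete])
      (auto simp: fixed_def k)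
  show "hilbert_space (V\<lparr>carrier := antifixed\<rparr>) (\<lambda>x y. - k x y)"
    by (rule hilbert_space_closed_submodule[OF submodule_antifixed closure_subset_antifixed complete])
      (auto simp: antifixed_def k ip_uminus_left)
qed (rule submodule_fixed submodule_antifixed)+

theorem krein_space_fixed:
  assumes "Metric_space.mcomplete (carrier V) (ip_dist V h)"
    and k: "\<And>x y. x \<in> carrier V \<Longrightarrow> y \<in> carrier V \<Longrightarrow> k x y = h (S x) y"
  shows "krein_space V k"
proof -
  have "cnj (k x y) = k y x" if "x \<in> carrier V" "y \<in> carrier V" for x y
    using that ip_sym[of "S x" y] by (simp add: k S_selfadjoint)
  then have "hermitian_form V k"
    unfolding hermitian_form_def by (auto simp: k S_add S_smult ip_add_left ip_smult_left)
  then show ?thesis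
    unfolding krein_space_def
    using module_axioms fundamental_decomposition_fixed[OF assms] by blast
qed

end

section \<open>Reflection of the line\<close>

lemma measurable_uminus_lebesgue [measurable]: "uminus \<in> lebesgue \<rightarrow>\<^sub>M (lebesgue :: real measure)"
proof -
  have "(*\<^sub>R) (-1) = (uminus :: real \<Rightarrow> real)" by (simp add: fun_eq_iff)
  then show ?thesis using lebesgue_measurable_scaling[of "-1", where 'a = real] by (simp only:)
qed

lemma borel_measurable_reflect [measurable (raw)]:
  fixes f :: "real \<Rightarrow> 'b::topological_space"
  assumes "f \<in> borel_measurable lebesgue"
  shows "(\<lambda>x. f (- x)) \<in> borel_measurable lebesgue"
  using measurable_compose[OF measurable_uminus_lebesgue assms] .

lemma AE_reflect:
  assumes "AE x in lebesgue. P x"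
  shows "AE x in lebesgue. P (- x :: real)"
proof (rule AE_distrD[OF measurable_uminus_lebesgue])
  have eq: "distr lebesgue lebesgue (uminus :: real \<Rightarrow> real) = lebesgue"
    using lebesgue_real_affine[of "-1" 0] by (simp add: density_1)
  show "AE x in distr lebesgue lebesgue uminus. P x" unfolding eq by (rule assms)
qed

lemma integrable_reflect_iff:
  fixes f :: "real \<Rightarrow> 'b::euclidean_space"
  shows "integrable lebesgue (\<lambda>x. f (- x)) \<longleftrightarrow> integrable lebesgue f"
  using lebesgue_integrable_real_affine_iff[of "-1" f 0] by simp

lemma integral_reflect:
  fixes f :: "real \<Rightarrow> 'b::euclidean_space"
  shows "(LINT x|lebesgue. f (- x)) = integral\<^sup>L lebesgue f"
  using lebesgue_integral_real_affine[of "-1" f 0] by simp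

text \<open>An integral over the line depends only on the even part of its integrand. All identities
  between forms below are identities between these even parts.\<close>

lemma integral_eq_by_symmetrization:
  fixes F G :: "real \<Rightarrow> 'b::euclidean_space"
  assumes F: "integrable lebesgue F" and G: "integrable lebesgue G"
    and eq: "AE x in lebesgue. F x + F (- x) = G x + G (- x)"
  shows "integral\<^sup>L lebesgue F = integral\<^sup>L lebesgue G"
proof -
  have sym: "(LINT x|lebesgue. H x + H (- x)) = 2 *\<^sub>R integral\<^sup>L lebesgue H"
    if H: "integrable lebesgue H" for H :: "real \<Rightarrow> 'b"
  proof -
    have "integrable lebesgue (\<lambda>x. H (- x))" using H by (simp add: integrable_reflect_iff)
    then show ?thesis using H by (simp add: integral_reflect scaleR_2)
  qed
  have "(LINT x|lebesgue. F x + F (- x)) = (LINT x|lebesgue. G x + G (- x))"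
    using F G eq by (intro integral_cong_AE) (auto intro!: borel_measurable_add borel_measurable_reflect)
  then show ?thesis using sym F G by simp
qed

section \<open>Completeness of square integrable functions\<close>

text \<open>Finiteness of the weighted sum of squares makes \<open>d k\<close> eventually smaller than a geometric
  sequence.\<close>

lemma summable_weighted_square_imp_summable:
  fixes d :: "nat \<Rightarrow> real"
  assumes d: "summable (\<lambda>k. 2 ^ k * (d k)\<^sup>2)" and nn: "\<And>k. 0 \<le> d k"
  shows "summable d"
proof (rule summable_comparison_test_ev)
  have "\<forall>\<^sub>F k in sequentially. 2 ^ k * (d k)\<^sup>2 < 1"
    using order_tendstoD(2)[OF summable_LIMSEQ_zero[OF d], of 1] by simp
  then show "\<forall>\<^sub>F k in sequentially. norm (d k) \<le> (sqrt (1/2)) ^ k"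
  proof eventually_elim
    case (elim k)
    have "(d k)\<^sup>2 \<le> (1/2) ^ k" using elim by (simp add: field_simps)
    then have "d k \<le> sqrt ((1/2) ^ k)" by (rule real_le_rsqrt)
    then show ?case using nn by (simp add: real_sqrt_power)
  qed
  show "summable (\<lambda>k. sqrt (1/2) ^ k)" by (rule summable_geometric) simp
qed

lemma summable_increments_imp_convergent:
  fixes f :: "nat \<Rightarrow> 'b::banach"
  assumes "summable (\<lambda>k. norm (f (Suc k) - f k))"
  shows "convergent f"
proof -
  have "convergent (\<lambda>n. \<Sum>k<n. f (Suc k) - f k)"
    using summable_norm_cancel[OF assms] by (simp add: summable_iff_convergent)
  then have "convergent (\<lambda>n. f n - f 0 + f 0)"
    unfolding sum_lessThan_telescope by (intro convergent_add convergent_const)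
  then show ?thesis by simp
qed

text \<open>Pass to a subsequence whose increments have squared norm at most \<open>4 ^ -k\<close>. The integral of the
  squared increments with weights \<open>2 ^ k\<close> is finite, so almost everywhere the increments are
  summable and the subsequence converges. Fatou's lemma carries the Cauchy estimate over to the limit.\<close>

lemma riesz_fischer:
  fixes h :: "nat \<Rightarrow> 'a \<Rightarrow> 'b::{banach, second_countable_topology}"
  assumes [measurable]: "\<And>n. h n \<in> borel_measurable M"
    and cauchy: "\<And>e::real. e > 0 \<Longrightarrow>
      \<exists>N. \<forall>m\<ge>N. \<forall>n\<ge>N. (\<integral>\<^sup>+x. ennreal ((norm (h m x - h n x))\<^sup>2) \<partial>M) \<le> ennreal e"
  obtains g where "g \<in> borel_measurable M"
    and "\<And>e::real. e > 0 \<Longrightarrow>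
      \<exists>N. \<forall>n\<ge>N. (\<integral>\<^sup>+x. ennreal ((norm (h n x - g x))\<^sup>2) \<partial>M) \<le> ennreal e"
proof -
  have "\<exists>N. \<forall>k. \<forall>m\<ge>N k. \<forall>n\<ge>N k.
      (\<integral>\<^sup>+x. ennreal ((norm (h m x - h n x))\<^sup>2) \<partial>M) \<le> ennreal ((1/4) ^ k)"
    using cauchy by (intro choice allI) simp
  then obtain N where N: "\<And>k m n. m \<ge> N k \<Longrightarrow> n \<ge> N k \<Longrightarrow>
      (\<integral>\<^sup>+x. ennreal ((norm (h m x - h n x))\<^sup>2) \<partial>M) \<le> ennreal ((1/4) ^ k)"
    by blast
  \<comment> \<open>The summand \<open>k\<close> makes \<open>p\<close> unbounded, and the sum makes \<open>p (Suc k)\<close> exceed \<open>N k\<close> too.\<close>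
  define p where "p k = k + (\<Sum>i\<le>k. N i)" for k
  have pN: "p k \<ge> N k" for k using member_le_sum[of k "{..k}" N] by (simp add: p_def)
  have p_ge: "p k \<ge> k" for k by (simp add: p_def)
  have p_Suc: "p (Suc k) \<ge> N k" for k using pN[of k] by (simp add: p_def)
  define D where "D k x = norm (h (p (Suc k)) x - h (p k) x)" for k x
  have [measurable]: "D k \<in> borel_measurable M" for k unfolding D_def by measurable
  have "(\<integral>\<^sup>+x. (\<Sum>k. ennreal (2 ^ k * (D k x)\<^sup>2)) \<partial>M)
      = (\<Sum>k. \<integral>\<^sup>+x. ennreal (2 ^ k * (D k x)\<^sup>2) \<partial>M)"
    by (intro nn_integral_suminf) measurable
  also have "\<dots> \<le> (\<Sum>k. ennreal ((1/2) ^ k))"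
  proof (intro suminf_le)
    fix k
    have "(\<integral>\<^sup>+x. ennreal (2 ^ k * (D k x)\<^sup>2) \<partial>M) = ennreal (2 ^ k) * (\<integral>\<^sup>+x. ennreal ((D k x)\<^sup>2) \<partial>M)"
      by (subst nn_integral_cmult[symmetric]) (auto simp: ennreal_mult)
    also have "\<dots> \<le> ennreal (2 ^ k) * ennreal ((1/4) ^ k)"
      unfolding D_def by (intro mult_left_mono N pN p_Suc) simp
    also have "\<dots> = ennreal ((1/2) ^ k)"
      by (simp add: ennreal_mult[symmetric] power_mult_distrib[symmetric])
    finally show "(\<integral>\<^sup>+x. ennreal (2 ^ k * (D k x)\<^sup>2) \<partial>M) \<le> ennreal ((1/2) ^ k)" .
  qed auto
  also have "\<dots> < \<infinity>"
    by (subst suminf_ennreal_eq[OF _ geometric_sums]) auto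
  finally have "AE x in M. (\<Sum>k. ennreal (2 ^ k * (D k x)\<^sup>2)) \<noteq> \<infinity>"
    by (intro nn_integral_noteq_infinite) auto
  then have conv: "AE x in M. convergent (\<lambda>k. h (p k) x)"
  proof eventually_elim
    case (elim x)
    have "summable (\<lambda>k. 2 ^ k * (D k x)\<^sup>2)"
      using elim by (intro summable_suminf_not_top) auto
    then have "summable (\<lambda>k. D k x)"
      by (rule summable_weighted_square_imp_summable) (simp add: D_def)
    then show ?case unfolding D_def by (rule summable_increments_imp_convergent)
  qed
  define g where "g x = lim (\<lambda>k. h (p k) x)" for x
  have [measurable]: "g \<in> borel_measurable M" unfolding g_def by measurable
  show thesis
  proof (rule that[of g])
    fix e :: real assume "e > 0"
    then obtain K where K: "\<And>m n. m \<ge> K \<Longrightarrow> n \<ge> K \<Longrightarrow>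
        (\<integral>\<^sup>+x. ennreal ((norm (h m x - h n x))\<^sup>2) \<partial>M) \<le> ennreal e"
      using cauchy by blast
    have "(\<integral>\<^sup>+x. ennreal ((norm (h n x - g x))\<^sup>2) \<partial>M) \<le> ennreal e" if n: "n \<ge> K" for n
    proof -
      have "(\<integral>\<^sup>+x. ennreal ((norm (h n x - g x))\<^sup>2) \<partial>M)
          = (\<integral>\<^sup>+x. liminf (\<lambda>k. ennreal ((norm (h n x - h (p k) x))\<^sup>2)) \<partial>M)"
      proof (rule nn_integral_cong_AE)
        show "AE x in M. ennreal ((norm (h n x - g x))\<^sup>2)
            = liminf (\<lambda>k. ennreal ((norm (h n x - h (p k) x))\<^sup>2))"
          using conv
        proof eventually_elim
          case (elim x)
          then have "(\<lambda>k. h (p k) x) \<longlonglongrightarrow> g x" by (simp add: g_def convergent_LIMSEQ_iff)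
          then have "(\<lambda>k. ennreal ((norm (h n x - h (p k) x))\<^sup>2))
              \<longlonglongrightarrow> ennreal ((norm (h n x - g x))\<^sup>2)"
            by (intro tendsto_ennrealI tendsto_intros)
          then show ?case by (intro lim_imp_Liminf[symmetric]) auto
        qed
      qed
      also have "\<dots> \<le> liminf (\<lambda>k. \<integral>\<^sup>+x. ennreal ((norm (h n x - h (p k) x))\<^sup>2) \<partial>M)"
        by (intro nn_integral_liminf) measurable
      also have "\<dots> \<le> limsup (\<lambda>k. \<integral>\<^sup>+x. ennreal ((norm (h n x - h (p k) x))\<^sup>2) \<partial>M)"
        by (intro Liminf_le_Limsup) simp
      also have "\<dots> \<le> ennreal e"
      proof (intro Limsup_bounded eventually_sequentiallyI)
        show "(\<integral>\<^sup>+x. ennreal ((norm (h n x - h (p k) x))\<^sup>2) \<partial>M) \<le> ennreal e" if "k \<ge> K" for k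
          using that p_ge[of k] by (intro K n) linarith
      qed
      finally show ?thesis .
    qed
    then show "\<exists>N. \<forall>n\<ge>N. (\<integral>\<^sup>+x. ennreal ((norm (h n x - g x))\<^sup>2) \<partial>M) \<le> ennreal e" by blast
  qed measurable
qed

section \<open>Weighted square integrable functions\<close>

lemma borel_measurable_cnj [measurable (raw)]:
  "f \<in> borel_measurable M \<Longrightarrow> (\<lambda>x. cnj (f x)) \<in> borel_measurable M"
  by (rule measurable_compose[OF _ borel_measurable_continuous_onI]) (auto intro: continuous_intros)

lemma borel_measurable_complex_of_real [measurable (raw)]:
  "f \<in> borel_measurable M \<Longrightarrow> (\<lambda>x. complex_of_real (f x)) \<in> borel_measurable M"
  by (rule measurable_compose[OF _ borel_measurable_continuous_onI]) (auto intro: continuous_intros)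

lemma L2_weight_measurable: "f \<in> L2_weight w \<Longrightarrow> f \<in> borel_measurable lebesgue"
  by (simp add: L2_weight_def)

text \<open>The right-hand side has two terms because a function is mostly compared with \<open>f x\<close> and
  \<open>f (- x)\<close>, or with its even and its odd part.\<close>

lemma L2_weight_dominated:
  assumes f: "f \<in> borel_measurable lebesgue" and v: "v \<in> borel_measurable lebesgue"
    and g: "g \<in> L2_weight u" and h: "h \<in> L2_weight w"
    and bound: "AE x in lebesgue. (cmod (f x))\<^sup>2 * \<bar>v x\<bar>
      \<le> C * ((cmod (g x))\<^sup>2 * \<bar>u x\<bar> + (cmod (h x))\<^sup>2 * \<bar>w x\<bar>)"
  shows "f \<in> L2_weight v"
proof -
  have "integrable lebesgue (\<lambda>x. (cmod (f x))\<^sup>2 * \<bar>v x\<bar>)"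
  proof (rule Bochner_Integration.integrable_bound)
    show "integrable lebesgue (\<lambda>x. C * ((cmod (g x))\<^sup>2 * \<bar>u x\<bar> + (cmod (h x))\<^sup>2 * \<bar>w x\<bar>))"
      using g h by (auto simp: L2_weight_def)
    show "(\<lambda>x. (cmod (f x))\<^sup>2 * \<bar>v x\<bar>) \<in> borel_measurable lebesgue" using f v by measurable
    show "AE x in lebesgue. norm ((cmod (f x))\<^sup>2 * \<bar>v x\<bar>)
        \<le> norm (C * ((cmod (g x))\<^sup>2 * \<bar>u x\<bar> + (cmod (h x))\<^sup>2 * \<bar>w x\<bar>))"
      using bound by eventually_elim auto
  qed
  then show ?thesis using f by (simp add: L2_weight_def)
qed

lemma cmod_add_squared_le: "(cmod (a + b))\<^sup>2 \<le> 2 * ((cmod a)\<^sup>2 + (cmod b)\<^sup>2)"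
proof -
  have "(cmod (a + b))\<^sup>2 \<le> (cmod a + cmod b)\<^sup>2" by (intro power_mono norm_triangle_ineq) simp
  also have "\<dots> \<le> 2 * ((cmod a)\<^sup>2 + (cmod b)\<^sup>2)"
    using zero_le_power2[of "cmod a - cmod b"] by (simp add: power2_sum power2_diff)
  finally show ?thesis .
qed

lemma L2_weight_add:
  assumes w: "w \<in> borel_measurable lebesgue" and f: "f \<in> L2_weight w" and g: "g \<in> L2_weight w"
  shows "(\<lambda>x. f x + g x) \<in> L2_weight w"
proof (rule L2_weight_dominated[OF _ w f g, where C = 2])
  show "(\<lambda>x. f x + g x) \<in> borel_measurable lebesgue"
    using f g by (intro borel_measurable_add L2_weight_measurable)
  show "AE x in lebesgue. (cmod (f x + g x))\<^sup>2 * \<bar>w x\<bar>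
      \<le> 2 * ((cmod (f x))\<^sup>2 * \<bar>w x\<bar> + (cmod (g x))\<^sup>2 * \<bar>w x\<bar>)"
  proof (rule AE_I2)
    fix x
    show "(cmod (f x + g x))\<^sup>2 * \<bar>w x\<bar> \<le> 2 * ((cmod (f x))\<^sup>2 * \<bar>w x\<bar> + (cmod (g x))\<^sup>2 * \<bar>w x\<bar>)"
      using mult_right_mono[OF cmod_add_squared_le[of "f x" "g x"], of "\<bar>w x\<bar>"]
      by (simp add: algebra_simps)
  qed
qed

lemma L2_weight_mult_bounded:
  assumes w: "w \<in> borel_measurable lebesgue" and f: "f \<in> L2_weight w"
    and c: "c \<in> borel_measurable lebesgue" and bound: "\<And>x. cmod (c x) \<le> B"
  shows "(\<lambda>x. c x * f x) \<in> L2_weight w"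
proof (rule L2_weight_dominated[OF _ w f f, where C = "B\<^sup>2"])
  show "(\<lambda>x. c x * f x) \<in> borel_measurable lebesgue"
    by (intro borel_measurable_times c L2_weight_measurable[OF f])
  show "AE x in lebesgue. (cmod (c x * f x))\<^sup>2 * \<bar>w x\<bar>
      \<le> B\<^sup>2 * ((cmod (f x))\<^sup>2 * \<bar>w x\<bar> + (cmod (f x))\<^sup>2 * \<bar>w x\<bar>)"
  proof (rule AE_I2)
    fix x
    have "(cmod (c x))\<^sup>2 \<le> B\<^sup>2" using bound[of x] by (intro power_mono) auto
    then have "(cmod (c x))\<^sup>2 * ((cmod (f x))\<^sup>2 * \<bar>w x\<bar>) \<le> B\<^sup>2 * ((cmod (f x))\<^sup>2 * \<bar>w x\<bar>)"
      by (intro mult_right_mono) auto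
    moreover have "0 \<le> B\<^sup>2 * ((cmod (f x))\<^sup>2 * \<bar>w x\<bar>)" by simp
    ultimately show "(cmod (c x * f x))\<^sup>2 * \<bar>w x\<bar>
      \<le> B\<^sup>2 * ((cmod (f x))\<^sup>2 * \<bar>w x\<bar> + (cmod (f x))\<^sup>2 * \<bar>w x\<bar>)"
      unfolding norm_mult power_mult_distrib distrib_left mult.assoc by linarith
  qed
qed

lemma L2_weight_product_integrable:
  assumes f: "f \<in> L2_weight w" and g: "g \<in> L2_weight w" and v: "v \<in> borel_measurable lebesgue"
    and bound: "AE x in lebesgue. \<bar>v x\<bar> \<le> C * \<bar>w x\<bar>"
  shows "integrable lebesgue (\<lambda>x. f x * cnj (g x) * complex_of_real (v x))"
proof (rule Bochner_Integration.integrable_bound)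
  show "integrable lebesgue (\<lambda>x. C * ((cmod (f x))\<^sup>2 * \<bar>w x\<bar> + (cmod (g x))\<^sup>2 * \<bar>w x\<bar>))"
    using f g by (auto simp: L2_weight_def)
  note [measurable] = L2_weight_measurable[OF f] L2_weight_measurable[OF g] v
  show "(\<lambda>x. f x * cnj (g x) * complex_of_real (v x)) \<in> borel_measurable lebesgue" by measurable
  show "AE x in lebesgue. norm (f x * cnj (g x) * complex_of_real (v x))
      \<le> norm (C * ((cmod (f x))\<^sup>2 * \<bar>w x\<bar> + (cmod (g x))\<^sup>2 * \<bar>w x\<bar>))"
    using bound
  proof eventually_elim
    case (elim x)
    let ?q = "(cmod (f x))\<^sup>2 + (cmod (g x))\<^sup>2"
    have "2 * (cmod (f x) * cmod (g x)) \<le> ?q"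
      using zero_le_power2[of "cmod (f x) - cmod (g x)"] by (simp add: power2_diff)
    moreover have "0 \<le> cmod (f x) * cmod (g x)" by simp
    ultimately have "cmod (f x) * cmod (g x) \<le> ?q" by linarith
    then have "norm (f x * cnj (g x) * complex_of_real (v x)) \<le> ?q * \<bar>v x\<bar>"
      by (simp add: norm_mult mult_right_mono)
    also have "\<dots> \<le> ?q * (C * \<bar>w x\<bar>)" using elim by (intro mult_left_mono) auto
    also have "\<dots> = C * ((cmod (f x))\<^sup>2 * \<bar>w x\<bar> + (cmod (g x))\<^sup>2 * \<bar>w x\<bar>)" by (simp add: algebra_simps)
    finally show ?case by simp
  qed
qed

lemma L2_weight_reflect:
  assumes w: "AE x in lebesgue. \<bar>w (- x)\<bar> = \<bar>w x\<bar>" and wm: "w \<in> borel_measurable lebesgue"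
    and f: "f \<in> L2_weight w"
  shows "(\<lambda>x. f (- x)) \<in> L2_weight w"
proof -
  have "integrable lebesgue (\<lambda>x. (cmod (f (- x)))\<^sup>2 * \<bar>w (- x)\<bar>)"
    using f integrable_reflect_iff[of "\<lambda>x. (cmod (f x))\<^sup>2 * \<bar>w x\<bar>"] by (simp add: L2_weight_def)
  moreover have "AE x in lebesgue. (cmod (f (- x)))\<^sup>2 * \<bar>w (- x)\<bar> = (cmod (f (- x)))\<^sup>2 * \<bar>w x\<bar>"
    using w by eventually_elim simp
  ultimately have "integrable lebesgue (\<lambda>x. (cmod (f (- x)))\<^sup>2 * \<bar>w x\<bar>)"
    using L2_weight_measurable[OF f] wm
    by (subst integrable_cong_AE[symmetric, where f = "\<lambda>x. (cmod (f (- x)))\<^sup>2 * \<bar>w (- x)\<bar>"]) auto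
  then show ?thesis using L2_weight_measurable[OF f] by (simp add: L2_weight_def borel_measurable_reflect)
qed

section \<open>Even and odd parts\<close>

lemma even_part_reflect: "even_part f (- x) = even_part f x"
  and odd_part_reflect: "odd_part f (- x) = - odd_part f x"
  by (simp_all add: even_part_def odd_part_def field_simps)

lemma even_plus_odd: "even_part f x + odd_part f x = f x"
  by (simp add: even_part_def odd_part_def field_simps)

lemma even_part_measurable [measurable (raw)]:
  assumes [measurable]: "f \<in> borel_measurable lebesgue"
  shows "even_part f \<in> borel_measurable lebesgue"
  unfolding even_part_def by measurable

lemma odd_part_measurable [measurable (raw)]:
  assumes [measurable]: "f \<in> borel_measurable lebesgue"
  shows "odd_part f \<in> borel_measurable lebesgue"
  unfolding odd_part_def by measurable

lemma cmod_even_odd: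
  "2 * ((cmod (even_part f x))\<^sup>2 + (cmod (odd_part f x))\<^sup>2) = (cmod (f x))\<^sup>2 + (cmod (f (- x)))\<^sup>2"
  unfolding even_part_def odd_part_def cmod_power2 by (simp add: power2_eq_square field_simps)

lemma product_even_sum:
  "f x * cnj (g x) + f (- x) * cnj (g (- x))
    = 2 * (even_part f x * cnj (even_part g x) + odd_part f x * cnj (odd_part g x))"
  unfolding even_part_def odd_part_def by (simp add: field_simps)

text \<open>Against an odd weight the two products of parts with equal parity cancel.\<close>

lemma product_odd_sum:
  "f x * cnj (g x) - f (- x) * cnj (g (- x))
    = 2 * (even_part f x * cnj (odd_part g x) + odd_part f x * cnj (even_part g x))"
  unfolding even_part_def odd_part_def by (simp add: field_simps)

text \<open>For even positive \<open>s\<close> this scales the even and the odd part by reciprocal factors. It keeps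
  the mixed terms of even and odd parts, and so every integral of \<open>f * cnj g\<close> against an odd
  weight over a symmetric interval.\<close>

definition twist :: "(real \<Rightarrow> real) \<Rightarrow> (real \<Rightarrow> complex) \<Rightarrow> real \<Rightarrow> complex"
  where "twist s f x = complex_of_real (s x) * even_part f x + odd_part f x / complex_of_real (s x)"

lemma twist_measurable [measurable]:
  assumes [measurable]: "s \<in> borel_measurable lebesgue" "f \<in> borel_measurable lebesgue"
  shows "twist s f \<in> borel_measurable lebesgue"
  unfolding twist_def by measurable

lemma even_part_twist: "s (- x) = s x \<Longrightarrow> even_part (twist s f) x = complex_of_real (s x) * even_part f x"
  by (subst even_part_def) (simp add: twist_def even_part_reflect odd_part_reflect)

lemma odd_part_twist: "s (- x) = s x \<Longrightarrow> odd_part (twist s f) x = odd_part f x / complex_of_real (s x)"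
  by (subst odd_part_def) (simp add: twist_def even_part_reflect odd_part_reflect)

lemma twist_inverse:
  assumes "s (- x) = s x" "s x \<noteq> 0"
  shows "twist (\<lambda>x. 1 / s x) (twist s f) x = f x"
  using assms by (simp add: twist_def[of "\<lambda>x. 1 / s x"] even_part_twist odd_part_twist even_plus_odd)

lemma even_part_linear: "even_part (\<lambda>x. a * f x + b * g x) x = a * even_part f x + b * even_part g x"
  and odd_part_linear: "odd_part (\<lambda>x. a * f x + b * g x) x = a * odd_part f x + b * odd_part g x"
  by (simp_all add: even_part_def odd_part_def field_simps)

lemma twist_linear: "twist s (\<lambda>x. a * f x + b * g x) x = a * twist s f x + b * twist s g x"
  by (simp add: twist_def even_part_linear odd_part_linear field_simps add_divide_distrib)

lemma twist_mult_even:
  assumes "c (- x) = c x"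
  shows "twist s (\<lambda>x. c x * f x) x = c x * twist s f x"
  using assms by (simp add: twist_def even_part_def odd_part_def field_simps)

section \<open>The two weights\<close>

text \<open>The functions \<open>decay\<close> and \<open>growth\<close> are reciprocal, as the
  difference and the sum of two numbers whose squares differ by 1. In the form, the even part of a function
  turns out to carry the weight \<open>decay\<close> and the odd part the weight \<open>growth\<close>.\<close>

definition decay :: "real \<Rightarrow> real \<Rightarrow> real"
  where "decay \<alpha> x = sqrt (\<bar>x\<bar> powr \<alpha> + 1) - sqrt (\<bar>x\<bar> powr \<alpha>)"

definition growth :: "real \<Rightarrow> real \<Rightarrow> real"
  where "growth \<alpha> x = sqrt (\<bar>x\<bar> powr \<alpha> + 1) + sqrt (\<bar>x\<bar> powr \<alpha>)"

lemma decay_mult_growth: "decay \<alpha> x * growth \<alpha> x = 1"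
  by (simp add: decay_def growth_def algebra_simps)

lemma growth_ge_1: "1 \<le> growth \<alpha> x"
proof -
  have "1 \<le> sqrt (\<bar>x\<bar> powr \<alpha> + 1)" by (simp add: real_le_rsqrt)
  then show ?thesis by (simp add: growth_def add_increasing2)
qed

lemma decay_pos: "0 < decay \<alpha> x"
  by (simp add: decay_def)

lemma decay_le_growth: "decay \<alpha> x \<le> growth \<alpha> x"
  by (simp add: decay_def growth_def)

lemma growth_eq: "growth \<alpha> x = decay \<alpha> x + 2 * sqrt (\<bar>x\<bar> powr \<alpha>)"
  by (simp add: decay_def growth_def)

definition half_weight :: "real \<Rightarrow> real \<Rightarrow> real"
  where "half_weight \<alpha> x = sqrt (decay \<alpha> x)"

lemma half_weight_pos: "0 < half_weight \<alpha> x"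
  and half_weight_reflect: "half_weight \<alpha> (- x) = half_weight \<alpha> x"
  and half_weight_squared: "(half_weight \<alpha> x)\<^sup>2 = decay \<alpha> x"
  and half_weight_inverse_squared: "(1 / half_weight \<alpha> x)\<^sup>2 = growth \<alpha> x"
proof -
  show "0 < half_weight \<alpha> x" by (simp add: half_weight_def decay_pos)
  show "half_weight \<alpha> (- x) = half_weight \<alpha> x" by (simp add: half_weight_def decay_def)
  show sq: "(half_weight \<alpha> x)\<^sup>2 = decay \<alpha> x" using decay_pos[of \<alpha> x] by (simp add: half_weight_def)
  show "(1 / half_weight \<alpha> x)\<^sup>2 = growth \<alpha> x"
    using decay_mult_growth[of \<alpha> x] decay_pos[of \<alpha> x] by (simp add: power_divide sq field_simps)
qed

lemma weights_measurable [measurable]: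
  "(\<lambda>x. sqrt (\<bar>x\<bar> powr \<alpha>)) \<in> borel_measurable lebesgue"
  "decay \<alpha> \<in> borel_measurable lebesgue" "growth \<alpha> \<in> borel_measurable lebesgue"
  "half_weight \<alpha> \<in> borel_measurable lebesgue"
proof -
  show "(\<lambda>x. sqrt (\<bar>x\<bar> powr \<alpha>)) \<in> borel_measurable lebesgue"
    by (intro measurable_completion) measurable
  have d: "decay \<alpha> \<in> borel_measurable borel" unfolding decay_def by measurable
  then show "decay \<alpha> \<in> borel_measurable lebesgue" by (intro measurable_completion) simp
  show "growth \<alpha> \<in> borel_measurable lebesgue"
    unfolding growth_def by (intro measurable_completion) measurable
  show "half_weight \<alpha> \<in> borel_measurable lebesgue"
    unfolding half_weight_def using d by (intro measurable_completion) simp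
qed

lemma sgn_measurable_lebesgue [measurable]: "(sgn :: real \<Rightarrow> real) \<in> borel_measurable lebesgue"
  by (intro measurable_completion) simp

lemma indicator_Icc_measurable_lebesgue [measurable]:
  "(indicator {a..b} :: real \<Rightarrow> real) \<in> borel_measurable lebesgue"
  by (rule borel_measurable_indicator) simp

text \<open>With \<open>b = \<bar>x\<bar> powr (\<alpha> / 2)\<close> one has \<open>growth \<alpha> x \<le> 2 * b + 1\<close>. Away from 0, the number \<open>b\<close> is
  bounded below, and \<open>\<alpha> \<le> 2\<close> bounds it by a multiple of \<open>\<bar>x\<bar>\<close>. The first bound lets the
  weight \<open>omega\<close> control the odd part, the second lets \<open>decay\<close> control the weight \<open>r_minus\<close>.\<close>

lemma growth_bounds:
  assumes \<epsilon>: "0 < \<epsilon>" and \<alpha>: "0 \<le> \<alpha>" "\<alpha> \<le> 2" and x: "\<epsilon> < \<bar>x\<bar>"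
  defines "C \<equiv> 3 / min 1 \<epsilon>"
  shows "growth \<alpha> x \<le> C * sqrt (\<bar>x\<bar> powr \<alpha>)" and "growth \<alpha> x \<le> C * \<bar>x\<bar>"
proof -
  define m where "m = min 1 \<epsilon>"
  have m: "0 < m" "m \<le> 1" "m < \<bar>x\<bar>" using \<epsilon> x by (auto simp: m_def)
  define b where "b = \<bar>x\<bar> powr (\<alpha> / 2)"
  have b: "sqrt (\<bar>x\<bar> powr \<alpha>) = b"
    by (simp add: b_def powr_half_sqrt[symmetric] powr_powr)
  have b0: "b \<ge> 0" by (simp add: b_def)
  have "sqrt (b\<^sup>2 + 1) \<le> b + 1"
    using b0 by (intro real_le_lsqrt) (auto simp: power2_sum)
  moreover have "\<bar>x\<bar> powr \<alpha> = b\<^sup>2" by (metis b powr_ge_zero real_sqrt_pow2)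
  ultimately have g: "growth \<alpha> x \<le> 2 * b + 1" using b0 by (simp add: growth_def)
  have "m \<le> b"
  proof (cases "\<bar>x\<bar> \<ge> 1")
    case True
    then have "1 \<le> b" using \<alpha> by (simp add: b_def ge_one_powr_ge_zero)
    then show ?thesis using m by simp
  next
    case False
    have "m powr 1 \<le> m powr (\<alpha> / 2)" using m \<alpha> by (intro powr_mono') auto
    also have "\<dots> \<le> b" unfolding b_def using m \<alpha> by (intro powr_mono2) auto
    finally show ?thesis using m by simp
  qed
  then have "1 \<le> b / m" and "b \<le> b / m" using m b0 by (simp_all add: field_simps mult_le_cancel_left1 mult_left_le)
  then have "growth \<alpha> x \<le> 3 * (b / m)" using g by linarith
  then show "growth \<alpha> x \<le> C * sqrt (\<bar>x\<bar> powr \<alpha>)" by (simp add: C_def b m_def)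
  have "b \<le> \<bar>x\<bar> / m"
  proof (cases "\<bar>x\<bar> \<ge> 1")
    case True
    then have "b \<le> \<bar>x\<bar> powr 1" unfolding b_def using \<alpha> by (intro powr_mono) auto
    also have "\<dots> \<le> \<bar>x\<bar> / m" using m mult_right_mono[of m 1 "\<bar>x\<bar>"] True by (simp add: field_simps)
    finally show ?thesis .
  next
    case False
    then have "b \<le> 1" unfolding b_def using \<alpha> by (intro powr_le1) auto
    also have "\<dots> \<le> \<bar>x\<bar> / m" using m by simp
    finally show ?thesis .
  qed
  moreover have "1 \<le> \<bar>x\<bar> / m" using m by simp
  ultimately have "growth \<alpha> x \<le> 3 * (\<bar>x\<bar> / m)" using g by linarith
  then show "growth \<alpha> x \<le> C * \<bar>x\<bar>" by (simp add: C_def m_def)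
qed

section \<open>The form domain as a weighted L2 space\<close>

locale odd_weight =
  fixes r :: "real \<Rightarrow> real" and \<epsilon> \<alpha> :: real
  assumes locally_integrable: "locally_integrable r"
    and odd: "AE x in lebesgue. r (- x) = - r x"
    and \<epsilon>_pos: "\<epsilon> > 0"
    and vanishing: "AE x in lebesgue. x \<in> {-\<epsilon>..\<epsilon>} \<longrightarrow> r x = 0"
    and sign: "AE x in lebesgue. x \<in> {..<-\<epsilon>} \<union> {\<epsilon><..} \<longrightarrow> x * r x > 0"
    and \<alpha>: "\<alpha> \<in> {0..2}"
begin

lemma r_measurable [measurable]: "r \<in> borel_measurable lebesgue"
proof (rule borel_measurable_LIMSEQ_real)
  show "(\<lambda>x. indicator {- real n..real n} x * r x) \<in> borel_measurable lebesgue" for n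
    using locally_integrable compact_Icc[of "- real n" "real n"]
    by (auto simp: locally_integrable_def set_integrable_def)
  show "(\<lambda>n. indicator {- real n..real n} x * r x) \<longlonglongrightarrow> r x" for x
  proof (rule tendsto_eventually)
    obtain N :: nat where "\<bar>x\<bar> \<le> real N" using real_arch_simple by blast
    then show "\<forall>\<^sub>F n in sequentially. indicator {- real n..real n} x * r x = r x"
      by (intro eventually_sequentiallyI[of N]) (auto simp: indicator_def)
  qed
qed

text \<open>The conditions on \<open>r\<close> in the form in which they are used. The last conjunct says that up to
  null sets \<open>r\<close> is nonzero exactly where the bounds on \<open>growth\<close> are available.\<close>

lemma AE_r: "AE x in lebesgue. r (- x) = - r x \<and> sgn x * \<bar>r x\<bar> = r x \<and>
    (r x \<noteq> 0 \<longleftrightarrow> \<epsilon> < \<bar>x\<bar>)"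
  using odd vanishing sign
proof eventually_elim
  case (elim x)
  have "x \<in> {-\<epsilon>..\<epsilon>} \<longleftrightarrow> \<not> \<epsilon> < \<bar>x\<bar>" "x \<in> {..<-\<epsilon>} \<union> {\<epsilon><..} \<longleftrightarrow> \<epsilon> < \<bar>x\<bar>" by auto
  then show ?case
    using elim by (cases "\<epsilon> < \<bar>x\<bar>") (auto simp: sgn_if abs_if zero_less_mult_iff)
qed

lemma AE_abs_r_even: "AE x in lebesgue. \<bar>r (- x)\<bar> = \<bar>r x\<bar>"
  using odd by eventually_elim simp

definition bound_const where "bound_const = 3 / min 1 \<epsilon>"

lemma bound_const_pos: "0 < bound_const" using \<epsilon>_pos by (simp add: bound_const_def)

lemma growth_le:
  assumes "\<epsilon> < \<bar>x\<bar>"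
  shows "growth \<alpha> x \<le> bound_const * sqrt (\<bar>x\<bar> powr \<alpha>)" and "growth \<alpha> x \<le> bound_const * \<bar>x\<bar>"
  unfolding bound_const_def using growth_bounds[OF \<epsilon>_pos _ _ assms] \<alpha> by auto

lemma one_le_decay: 
  assumes "\<epsilon> < \<bar>x\<bar>" shows "1 \<le> bound_const * \<bar>x\<bar> * decay \<alpha> x"
  using mult_right_mono[OF growth_le(2)[OF assms], of "decay \<alpha> x"] decay_pos[of \<alpha> x]
    decay_mult_growth[of \<alpha> x] by (simp add: mult.commute)

lemma eta_eq: "eta r \<alpha> x = decay \<alpha> x * \<bar>r x\<bar>"
  by (simp add: eta_def decay_def)

lemma form_weights_measurable [measurable]:
  "eta r \<alpha> \<in> borel_measurable lebesgue" "omega r \<alpha> \<in> borel_measurable lebesgue"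
  "r_minus r \<in> borel_measurable lebesgue"
proof -
  show "eta r \<alpha> \<in> borel_measurable lebesgue" unfolding eta_eq[abs_def] by measurable
  show "omega r \<alpha> \<in> borel_measurable lebesgue" unfolding omega_def[abs_def] by measurable
  have "(\<lambda>x::real. 1 / x) \<in> borel_measurable lebesgue" by (intro measurable_completion) measurable
  then show "r_minus r \<in> borel_measurable lebesgue"
    unfolding r_minus_def[abs_def] by (rule borel_measurable_times[OF _ r_measurable])
qed

text \<open>\<open>\<Phi>\<close> is the unitary map from the form domain onto the square integrable functions with weight
  \<open>\<bar>r x\<bar>\<close>, and \<open>\<Psi>\<close> is its inverse.\<close>

abbreviation \<Phi> :: "(real \<Rightarrow> complex) \<Rightarrow> real \<Rightarrow> complex"
  where "\<Phi> \<equiv> twist (half_weight \<alpha>)"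

abbreviation \<Psi> :: "(real \<Rightarrow> complex) \<Rightarrow> real \<Rightarrow> complex"
  where "\<Psi> \<equiv> twist (\<lambda>x. 1 / half_weight \<alpha> x)"

lemma \<Psi>_\<Phi>: "\<Psi> (\<Phi> f) x = f x" and \<Phi>_\<Psi>: "\<Phi> (\<Psi> f) x = f x"
proof -
  have *: "half_weight \<alpha> x \<noteq> 0" using half_weight_pos[of \<alpha> x] by simp
  show "\<Psi> (\<Phi> f) x = f x" using * by (simp add: twist_inverse half_weight_reflect)
  show "\<Phi> (\<Psi> f) x = f x"
    using twist_inverse[of "\<lambda>x. 1 / half_weight \<alpha> x" x f] * by (simp add: half_weight_reflect)
qed

lemma even_part_\<Phi>: "even_part (\<Phi> f) x = complex_of_real (half_weight \<alpha> x) * even_part f x"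
  and odd_part_\<Phi>: "odd_part (\<Phi> f) x = odd_part f x / complex_of_real (half_weight \<alpha> x)"
  by (simp_all add: even_part_twist odd_part_twist half_weight_reflect)

lemma cmod_even_part_\<Phi>: "(cmod (even_part (\<Phi> f) x))\<^sup>2 = decay \<alpha> x * (cmod (even_part f x))\<^sup>2"
  and cmod_odd_part_\<Phi>: "(cmod (odd_part (\<Phi> f) x))\<^sup>2 = growth \<alpha> x * (cmod (odd_part f x))\<^sup>2"
  using half_weight_pos[of \<alpha> x]
  by (simp_all add: even_part_\<Phi> odd_part_\<Phi> norm_mult norm_divide power_mult_distrib power_divide
      half_weight_squared half_weight_inverse_squared[symmetric])

lemma \<Phi>_energy:
  "(cmod (\<Phi> f x))\<^sup>2 + (cmod (\<Phi> f (- x)))\<^sup>2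
    = 2 * (decay \<alpha> x * (cmod (even_part f x))\<^sup>2 + growth \<alpha> x * (cmod (odd_part f x))\<^sup>2)"
  by (simp add: cmod_even_odd[symmetric] cmod_even_part_\<Phi> cmod_odd_part_\<Phi>)

lemma decay_cmod_le_\<Phi>:
  "decay \<alpha> x * (cmod (f x))\<^sup>2 \<le> (cmod (\<Phi> f x))\<^sup>2 + (cmod (\<Phi> f (- x)))\<^sup>2"
proof -
  have "(cmod (f x))\<^sup>2 \<le> 2 * ((cmod (even_part f x))\<^sup>2 + (cmod (odd_part f x))\<^sup>2)"
    unfolding cmod_even_odd by simp
  then have "decay \<alpha> x * (cmod (f x))\<^sup>2
      \<le> decay \<alpha> x * (2 * ((cmod (even_part f x))\<^sup>2 + (cmod (odd_part f x))\<^sup>2))"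
    using decay_pos[of \<alpha> x] by (intro mult_left_mono) auto
  moreover have "decay \<alpha> x * (cmod (odd_part f x))\<^sup>2 \<le> growth \<alpha> x * (cmod (odd_part f x))\<^sup>2"
    using decay_le_growth by (intro mult_right_mono) auto
  ultimately show ?thesis unfolding \<Phi>_energy by (simp add: algebra_simps)
qed

text \<open>By reflection, \<open>\<Phi> f x\<close> and \<open>\<Phi> f (- x)\<close> are square integrable together. Their squares add up
  to the weighted squares of both parts of \<open>f\<close>.\<close>

lemma L2_\<Phi>_dominates:
  assumes f: "f \<in> borel_measurable lebesgue" and v: "v \<in> borel_measurable lebesgue"
    and \<Phi>: "\<Phi> f \<in> L2_weight r" and h: "h \<in> borel_measurable lebesgue"
    and bound: "AE x in lebesgue. (cmod (h x))\<^sup>2 * \<bar>v x\<bar>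
      \<le> B * (((cmod (\<Phi> f x))\<^sup>2 + (cmod (\<Phi> f (- x)))\<^sup>2) * \<bar>r x\<bar>)"
  shows "h \<in> L2_weight v"
  by (rule L2_weight_dominated[OF h v \<Phi> L2_weight_reflect[OF AE_abs_r_even r_measurable \<Phi>], where C = B])
    (use bound in \<open>simp add: distrib_right\<close>)

text \<open>The three integrability conditions of the form domain amount to one. From left to right, the
  odd part needs \<open>growth \<alpha> x \<le> bound_const * sqrt (\<bar>x\<bar> powr \<alpha>)\<close>; from right to left, the
  condition on \<open>r_minus\<close> needs \<open>1 / \<bar>x\<bar> \<le> bound_const * decay \<alpha> x\<close>.\<close>

lemma dom_t_fun_iff: "f \<in> dom_t_fun r \<alpha> \<longleftrightarrow> f \<in> borel_measurable lebesgue \<and> \<Phi> f \<in> L2_weight r"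
proof (intro iffI conjI)
  assume f: "f \<in> dom_t_fun r \<alpha>"
  then show fm: "f \<in> borel_measurable lebesgue" by (simp add: dom_t_fun_def L2_weight_def)
  have e: "even_part f \<in> L2_weight (eta r \<alpha>)" and o: "odd_part f \<in> L2_weight (omega r \<alpha>)"
    using f by (auto simp: dom_t_fun_def)
  show "\<Phi> f \<in> L2_weight r"
  proof (rule L2_weight_dominated[OF _ r_measurable e o, where C = "2 * (1 + bound_const)"])
    show "\<Phi> f \<in> borel_measurable lebesgue" using fm by measurable
    show "AE x in lebesgue. (cmod (\<Phi> f x))\<^sup>2 * \<bar>r x\<bar> \<le> 2 * (1 + bound_const) *
        ((cmod (even_part f x))\<^sup>2 * \<bar>eta r \<alpha> x\<bar> + (cmod (odd_part f x))\<^sup>2 * \<bar>omega r \<alpha> x\<bar>)"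
      using AE_r
    proof eventually_elim
      case (elim x)
      define e o' b R where "e = (cmod (even_part f x))\<^sup>2" and "o' = (cmod (odd_part f x))\<^sup>2"
        and "b = sqrt (\<bar>x\<bar> powr \<alpha>)" and "R = \<bar>r x\<bar>"
      have nn: "0 \<le> e" "0 \<le> o'" "0 \<le> b" "0 \<le> R" "0 < bound_const" "0 < decay \<alpha> x"
        by (auto simp: e_def o'_def b_def R_def bound_const_pos decay_pos)
      have "growth \<alpha> x * R \<le> bound_const * b * R"
        using elim growth_le(1)[of x] by (cases "r x = 0") (auto simp: R_def b_def intro: mult_right_mono)
      then have "o' * (growth \<alpha> x * R) \<le> o' * (bound_const * b * R)" using nn by (intro mult_left_mono)
      moreover have "(cmod (\<Phi> f x))\<^sup>2 * R \<le> 2 * (decay \<alpha> x * e + growth \<alpha> x * o') * R"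
        using nn \<Phi>_energy[of f x] zero_le_power2[of "cmod (\<Phi> f (- x))"]
        unfolding e_def o'_def by (intro mult_right_mono) linarith+
      moreover have "0 \<le> bound_const * (decay \<alpha> x * e * R)" "0 \<le> b * R * o'" using nn by auto
      ultimately have "(cmod (\<Phi> f x))\<^sup>2 * R \<le> 2 * (1 + bound_const) * (e * (decay \<alpha> x * R) + o' * (b * R))"
        by (simp add: algebra_simps)
      then show ?case
        using nn by (simp add: eta_eq omega_def e_def o'_def b_def R_def abs_mult)
    qed
  qed
next
  assume *: "f \<in> borel_measurable lebesgue \<and> \<Phi> f \<in> L2_weight r"
  note fm = conjunct1[OF *] and L2 = L2_\<Phi>_dominates[OF conjunct1[OF *] _ conjunct2[OF *]]
  have "f \<in> L2_weight (r_minus r)"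
  proof (rule L2[OF _ fm, where B = bound_const])
    show "AE x in lebesgue. (cmod (f x))\<^sup>2 * \<bar>r_minus r x\<bar>
        \<le> bound_const * (((cmod (\<Phi> f x))\<^sup>2 + (cmod (\<Phi> f (- x)))\<^sup>2) * \<bar>r x\<bar>)"
      using AE_r
    proof eventually_elim
      case (elim x)
      show ?case
      proof (cases "r x = 0")
        case False
        then have x: "\<epsilon> < \<bar>x\<bar>" using elim by simp
        then have "1 / \<bar>x\<bar> \<le> bound_const * decay \<alpha> x" using one_le_decay[OF x] \<epsilon>_pos by (simp add: field_simps)
        then have "(cmod (f x))\<^sup>2 * (1 / \<bar>x\<bar>) \<le> (cmod (f x))\<^sup>2 * (bound_const * decay \<alpha> x)"
          by (intro mult_left_mono) auto
        also have "\<dots> = bound_const * (decay \<alpha> x * (cmod (f x))\<^sup>2)" by simp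
        also have "\<dots> \<le> bound_const * ((cmod (\<Phi> f x))\<^sup>2 + (cmod (\<Phi> f (- x)))\<^sup>2)"
          using bound_const_pos by (intro mult_left_mono decay_cmod_le_\<Phi>) auto
        finally have "(cmod (f x))\<^sup>2 * (1 / \<bar>x\<bar>) * \<bar>r x\<bar>
            \<le> bound_const * ((cmod (\<Phi> f x))\<^sup>2 + (cmod (\<Phi> f (- x)))\<^sup>2) * \<bar>r x\<bar>"
          by (intro mult_right_mono) auto
        then show ?thesis by (simp add: r_minus_def abs_mult mult.assoc)
      qed (simp add: r_minus_def)
    qed
  qed measurable
  moreover have "even_part f \<in> L2_weight (eta r \<alpha>)"
  proof (rule L2[OF _ even_part_measurable[OF fm], where B = 1])
    show "AE x in lebesgue. (cmod (even_part f x))\<^sup>2 * \<bar>eta r \<alpha> x\<bar>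
        \<le> 1 * (((cmod (\<Phi> f x))\<^sup>2 + (cmod (\<Phi> f (- x)))\<^sup>2) * \<bar>r x\<bar>)"
    proof (rule AE_I2)
      fix x
      have "decay \<alpha> x * (cmod (even_part f x))\<^sup>2 \<le> (cmod (\<Phi> f x))\<^sup>2 + (cmod (\<Phi> f (- x)))\<^sup>2"
        using decay_pos[of \<alpha> x] growth_ge_1[of \<alpha> x] unfolding \<Phi>_energy by simp
      then have "decay \<alpha> x * (cmod (even_part f x))\<^sup>2 * \<bar>r x\<bar>
          \<le> ((cmod (\<Phi> f x))\<^sup>2 + (cmod (\<Phi> f (- x)))\<^sup>2) * \<bar>r x\<bar>"
        by (intro mult_right_mono) auto
      then show "(cmod (even_part f x))\<^sup>2 * \<bar>eta r \<alpha> x\<bar>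
        \<le> 1 * (((cmod (\<Phi> f x))\<^sup>2 + (cmod (\<Phi> f (- x)))\<^sup>2) * \<bar>r x\<bar>)"
        using decay_pos[of \<alpha> x] by (simp add: eta_eq abs_mult mult.assoc mult.left_commute)
    qed
  qed measurable
  moreover have "odd_part f \<in> L2_weight (omega r \<alpha>)"
  proof (rule L2[OF _ odd_part_measurable[OF fm], where B = 1])
    show "AE x in lebesgue. (cmod (odd_part f x))\<^sup>2 * \<bar>omega r \<alpha> x\<bar>
        \<le> 1 * (((cmod (\<Phi> f x))\<^sup>2 + (cmod (\<Phi> f (- x)))\<^sup>2) * \<bar>r x\<bar>)"
    proof (rule AE_I2)
      fix x
      have "sqrt (\<bar>x\<bar> powr \<alpha>) \<le> 2 * growth \<alpha> x" using decay_pos[of \<alpha> x] by (simp add: growth_eq)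
      then have "sqrt (\<bar>x\<bar> powr \<alpha>) * (cmod (odd_part f x))\<^sup>2 \<le> 2 * growth \<alpha> x * (cmod (odd_part f x))\<^sup>2"
        by (intro mult_right_mono) auto
      also have "\<dots> \<le> (cmod (\<Phi> f x))\<^sup>2 + (cmod (\<Phi> f (- x)))\<^sup>2"
        using decay_pos[of \<alpha> x] unfolding \<Phi>_energy by simp
      finally have "sqrt (\<bar>x\<bar> powr \<alpha>) * (cmod (odd_part f x))\<^sup>2 * \<bar>r x\<bar>
          \<le> ((cmod (\<Phi> f x))\<^sup>2 + (cmod (\<Phi> f (- x)))\<^sup>2) * \<bar>r x\<bar>"
        by (intro mult_right_mono) auto
      then show "(cmod (odd_part f x))\<^sup>2 * \<bar>omega r \<alpha> x\<bar>
        \<le> 1 * (((cmod (\<Phi> f x))\<^sup>2 + (cmod (\<Phi> f (- x)))\<^sup>2) * \<bar>r x\<bar>)"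
        by (simp add: omega_def abs_mult mult.assoc mult.left_commute)
    qed
  qed measurable
  ultimately show "f \<in> dom_t_fun r \<alpha>" by (simp add: dom_t_fun_def)
qed

lemma dom_measurable: "f \<in> dom_t_fun r \<alpha> \<Longrightarrow> f \<in> borel_measurable lebesgue"
  and dom_\<Phi>: "f \<in> dom_t_fun r \<alpha> \<Longrightarrow> \<Phi> f \<in> L2_weight r"
  by (simp_all add: dom_t_fun_iff)

lemma dom_in_L2_eta:
  assumes f: "f \<in> dom_t_fun r \<alpha>" shows "f \<in> L2_weight (eta r \<alpha>)"
proof (rule L2_\<Phi>_dominates[OF dom_measurable[OF f] _ dom_\<Phi>[OF f] dom_measurable[OF f], where B = 1])
  show "AE x in lebesgue. (cmod (f x))\<^sup>2 * \<bar>eta r \<alpha> x\<bar>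
        \<le> 1 * (((cmod (\<Phi> f x))\<^sup>2 + (cmod (\<Phi> f (- x)))\<^sup>2) * \<bar>r x\<bar>)"
  proof (rule AE_I2)
    fix x
    show "(cmod (f x))\<^sup>2 * \<bar>eta r \<alpha> x\<bar>
        \<le> 1 * (((cmod (\<Phi> f x))\<^sup>2 + (cmod (\<Phi> f (- x)))\<^sup>2) * \<bar>r x\<bar>)"
      using mult_right_mono[OF decay_cmod_le_\<Phi>[of x f], of "\<bar>r x\<bar>"] decay_pos[of \<alpha> x]
      by (simp add: eta_eq abs_mult mult.assoc mult.left_commute)
  qed
qed measurable

lemma \<Phi>_product_integrable:
  assumes "f \<in> dom_t_fun r \<alpha>" "g \<in> dom_t_fun r \<alpha>"
  shows "integrable lebesgue (\<lambda>x. \<Phi> f x * cnj (\<Phi> g x) * complex_of_real (r x))"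
    and "integrable lebesgue (\<lambda>x. \<Phi> f x * cnj (\<Phi> g x) * complex_of_real \<bar>r x\<bar>)"
  by (rule L2_weight_product_integrable[OF dom_\<Phi> dom_\<Phi>, where C = 1]; use assms in simp)+

text \<open>After symmetrization the odd parts carry the weight \<open>decay \<alpha> x + 2 * sqrt (\<bar>x\<bar> powr \<alpha>)\<close>, which
  is \<open>growth \<alpha> x\<close>. This is why the first term of the form has the factor 2.\<close>

lemma t_fun_eq:
  assumes f: "f \<in> dom_t_fun r \<alpha>" and g: "g \<in> dom_t_fun r \<alpha>"
  shows "t_fun r \<alpha> f g = (LINT x|lebesgue. \<Phi> f x * cnj (\<Phi> g x) * complex_of_real \<bar>r x\<bar>)"
proof -
  have 1: "integrable lebesgue (\<lambda>x. odd_part f x * cnj (odd_part g x) * complex_of_real (omega r \<alpha> x))"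
    by (rule L2_weight_product_integrable[where w = "omega r \<alpha>" and C = 1])
      (use f g in \<open>auto simp: dom_t_fun_def\<close>)
  have 2: "integrable lebesgue (\<lambda>x. f x * cnj (g x) * complex_of_real (eta r \<alpha> x))"
    by (rule L2_weight_product_integrable[where w = "eta r \<alpha>" and C = 1])
      (use dom_in_L2_eta f g in auto)
  have "t_fun r \<alpha> f g = (LINT x|lebesgue. 2 * (odd_part f x * cnj (odd_part g x) * complex_of_real (omega r \<alpha> x))
      + f x * cnj (g x) * complex_of_real (eta r \<alpha> x))"
    using 1 2 by (simp add: t_fun_def weight_ip_def)
  also have "\<dots> = (LINT x|lebesgue. \<Phi> f x * cnj (\<Phi> g x) * complex_of_real \<bar>r x\<bar>)"
  proof (rule integral_eq_by_symmetrization)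
    show "integrable lebesgue (\<lambda>x. 2 * (odd_part f x * cnj (odd_part g x) * complex_of_real (omega r \<alpha> x))
      + f x * cnj (g x) * complex_of_real (eta r \<alpha> x))" using 1 2 by simp
    show "integrable lebesgue (\<lambda>x. \<Phi> f x * cnj (\<Phi> g x) * complex_of_real \<bar>r x\<bar>)"
      using f g by (rule \<Phi>_product_integrable)
    show "AE x in lebesgue.
       2 * (odd_part f x * cnj (odd_part g x) * complex_of_real (omega r \<alpha> x)) +
       f x * cnj (g x) * complex_of_real (eta r \<alpha> x) +
       (2 * (odd_part f (- x) * cnj (odd_part g (- x)) * complex_of_real (omega r \<alpha> (- x))) +
        f (- x) * cnj (g (- x)) * complex_of_real (eta r \<alpha> (- x))) =
       \<Phi> f x * cnj (\<Phi> g x) * complex_of_real \<bar>r x\<bar> +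
       \<Phi> f (- x) * cnj (\<Phi> g (- x)) * complex_of_real \<bar>r (- x)\<bar>"
      using AE_abs_r_even
    proof eventually_elim
      case (elim x)
      define e where "e = even_part f x * cnj (even_part g x)"
      define d where "d = odd_part f x * cnj (odd_part g x)"
      define R where "R = complex_of_real \<bar>r x\<bar>"
      define b where "b = complex_of_real (sqrt (\<bar>x\<bar> powr \<alpha>))"
      have refl: "eta r \<alpha> (- x) = eta r \<alpha> x" "omega r \<alpha> (- x) = omega r \<alpha> x"
        using elim by (simp_all add: eta_def omega_def)
      have ev: "even_part (\<Phi> f) x * cnj (even_part (\<Phi> g) x) = complex_of_real (decay \<alpha> x) * e"
        by (simp add: even_part_\<Phi> e_def half_weight_squared[symmetric] power2_eq_square)
      have od: "odd_part (\<Phi> f) x * cnj (odd_part (\<Phi> g) x) = complex_of_real (growth \<alpha> x) * d"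
        by (simp add: odd_part_\<Phi> d_def half_weight_inverse_squared[symmetric] power2_eq_square)
      have "\<Phi> f x * cnj (\<Phi> g x) * R + \<Phi> f (- x) * cnj (\<Phi> g (- x)) * R
          = (\<Phi> f x * cnj (\<Phi> g x) + \<Phi> f (- x) * cnj (\<Phi> g (- x))) * R"
        by (simp add: algebra_simps)
      also have "\<dots> = 2 * (complex_of_real (decay \<alpha> x) * e + complex_of_real (growth \<alpha> x) * d) * R"
        unfolding product_even_sum ev od ..
      also have "\<dots> = 4 * d * b * R + 2 * (e + d) * complex_of_real (decay \<alpha> x) * R"
        by (simp add: growth_eq b_def algebra_simps)
      also have "2 * (e + d) = f x * cnj (g x) + f (- x) * cnj (g (- x))"
        unfolding product_even_sum e_def d_def ..
      finally show ?case
        unfolding refl odd_part_reflect unfolding elim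
        by (simp add: eta_eq omega_def R_def b_def d_def algebra_simps)
    qed
  qed
  finally show ?thesis .
qed

text \<open>On a bounded interval \<open>decay\<close> is bounded below where \<open>r\<close> does not vanish, so there the weight
  \<open>r\<close> is dominated by \<open>eta\<close>. No such domination holds on the whole line, and \<open>f * cnj g * r\<close>
  itself need not be integrable.\<close>

lemma set_integrable_product:
  assumes f: "f \<in> dom_t_fun r \<alpha>" and g: "g \<in> dom_t_fun r \<alpha>"
  shows "set_integrable lebesgue {-k..k} (\<lambda>x. f x * cnj (g x) * complex_of_real (r x))"
proof -
  have "integrable lebesgue (\<lambda>x. f x * cnj (g x) * complex_of_real (indicator {-k..k} x * r x))"
  proof (rule L2_weight_product_integrable[OF dom_in_L2_eta[OF f] dom_in_L2_eta[OF g], where C = "bound_const * \<bar>k\<bar>"])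
    show "AE x in lebesgue. \<bar>indicator {-k..k} x * r x\<bar> \<le> bound_const * \<bar>k\<bar> * \<bar>eta r \<alpha> x\<bar>"
      using AE_r
    proof eventually_elim
      case (elim x)
      show ?case
      proof (cases "r x \<noteq> 0 \<and> x \<in> {-k..k}")
        case True
        have "1 \<le> bound_const * \<bar>x\<bar> * decay \<alpha> x" using True elim by (intro one_le_decay) auto
        also have "\<dots> \<le> bound_const * \<bar>k\<bar> * decay \<alpha> x"
          using True bound_const_pos decay_pos[of \<alpha> x] by (intro mult_right_mono mult_left_mono) auto
        finally have "1 * \<bar>r x\<bar> \<le> bound_const * \<bar>k\<bar> * decay \<alpha> x * \<bar>r x\<bar>" by (intro mult_right_mono) auto
        then show ?thesis using True decay_pos[of \<alpha> x] by (simp add: eta_eq abs_mult)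
      qed (use bound_const_pos in auto)
    qed
  qed measurable
  moreover have "(\<lambda>x. f x * cnj (g x) * complex_of_real (indicator {-k..k} x * r x))
      = (\<lambda>x. indicator {-k..k} x *\<^sub>R (f x * cnj (g x) * complex_of_real (r x)))"
    by (auto simp: indicator_def fun_eq_iff)
  ultimately show ?thesis by (simp add: set_integrable_def)
qed

text \<open>For odd \<open>r\<close> only the mixed terms \<open>even_part f x * cnj (odd_part g x)\<close> and
  \<open>odd_part f x * cnj (even_part g x)\<close> survive symmetrization, and \<open>\<Phi>\<close> multiplies them by
  \<open>s x * (1 / s x) = 1\<close> for the half weight \<open>s\<close>.\<close>

lemma truncated_integral_eq:
  assumes f: "f \<in> dom_t_fun r \<alpha>" and g: "g \<in> dom_t_fun r \<alpha>"
  shows "(LINT x:{-k..k}|lebesgue. f x * cnj (g x) * complex_of_real (r x))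
    = (LINT x:{-k..k}|lebesgue. \<Phi> f x * cnj (\<Phi> g x) * complex_of_real (r x))"
  unfolding set_lebesgue_integral_def
proof (rule integral_eq_by_symmetrization)
  show "integrable lebesgue (\<lambda>x. indicator {-k..k} x *\<^sub>R (f x * cnj (g x) * complex_of_real (r x)))"
    using set_integrable_product[OF f g] by (simp add: set_integrable_def)
  show "integrable lebesgue (\<lambda>x. indicator {-k..k} x *\<^sub>R (\<Phi> f x * cnj (\<Phi> g x) * complex_of_real (r x)))"
    by (rule integrable_mult_indicator) (use \<Phi>_product_integrable[OF f g] in auto)
  have sym: "indicator {-k..k} (- x) = (indicator {-k..k} x :: real)" for x
    by (auto simp: indicator_def)
  show "AE x in lebesgue.
      indicator {-k..k} x *\<^sub>R (f x * cnj (g x) * complex_of_real (r x)) +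
      indicator {-k..k} (- x) *\<^sub>R (f (- x) * cnj (g (- x)) * complex_of_real (r (- x))) =
      indicator {-k..k} x *\<^sub>R (\<Phi> f x * cnj (\<Phi> g x) * complex_of_real (r x)) +
      indicator {-k..k} (- x) *\<^sub>R (\<Phi> f (- x) * cnj (\<Phi> g (- x)) * complex_of_real (r (- x)))"
    using odd
  proof eventually_elim
    case (elim x)
    have s: "half_weight \<alpha> x \<noteq> 0" using half_weight_pos[of \<alpha> x] by simp
    have "\<Phi> f x * cnj (\<Phi> g x) - \<Phi> f (- x) * cnj (\<Phi> g (- x)) = f x * cnj (g x) - f (- x) * cnj (g (- x))"
      unfolding product_odd_sum using s by (simp add: even_part_\<Phi> odd_part_\<Phi>)
    then have "(f x * cnj (g x) - f (- x) * cnj (g (- x))) * complex_of_real (r x)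
       = (\<Phi> f x * cnj (\<Phi> g x) - \<Phi> f (- x) * cnj (\<Phi> g (- x))) * complex_of_real (r x)" by simp
    then show ?case
      unfolding sym elim scaleR_add_right[symmetric]
      by (intro arg_cong[where f = "scaleR (indicator {-k..k} x)"]) (simp add: algebra_simps)
  qed
qed

text \<open>Unlike \<open>f * cnj g * r\<close>, the product \<open>\<Phi> f * cnj (\<Phi> g) * r\<close> is integrable on the whole line,
  so dominated convergence applies.\<close>

lemma tendsto_truncated_integral:
  assumes f: "f \<in> dom_t_fun r \<alpha>" and g: "g \<in> dom_t_fun r \<alpha>"
  shows "((\<lambda>k. LINT x:{-k..k}|lebesgue. f x * cnj (g x) * complex_of_real (r x))
    \<longlongrightarrow> (LINT x|lebesgue. \<Phi> f x * cnj (\<Phi> g x) * complex_of_real (r x))) at_top"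
  unfolding truncated_integral_eq[OF f g] unfolding set_lebesgue_integral_def
proof (rule integral_dominated_convergence_at_top
    [where w = "\<lambda>x. norm (\<Phi> f x * cnj (\<Phi> g x) * complex_of_real (r x))"])
  note int = \<Phi>_product_integrable(1)[OF f g]
  show m: "(\<lambda>x. \<Phi> f x * cnj (\<Phi> g x) * complex_of_real (r x)) \<in> borel_measurable lebesgue"
    using int by simp
  show "(\<lambda>x. indicator {-k..k} x *\<^sub>R (\<Phi> f x * cnj (\<Phi> g x) * complex_of_real (r x)))
      \<in> borel_measurable lebesgue" for k :: real
    by (rule borel_measurable_scaleR[OF indicator_Icc_measurable_lebesgue m])
  show "integrable lebesgue (\<lambda>x. norm (\<Phi> f x * cnj (\<Phi> g x) * complex_of_real (r x)))"
    using int by (rule integrable_norm)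
  show "AE x in lebesgue. ((\<lambda>k. indicator {-k..k} x *\<^sub>R (\<Phi> f x * cnj (\<Phi> g x) * complex_of_real (r x)))
      \<longlongrightarrow> \<Phi> f x * cnj (\<Phi> g x) * complex_of_real (r x)) at_top"
  proof (intro AE_I2 tendsto_eventually)
    fix x :: real
    show "\<forall>\<^sub>F k in at_top. indicator {-k..k} x *\<^sub>R (\<Phi> f x * cnj (\<Phi> g x) * complex_of_real (r x))
        = \<Phi> f x * cnj (\<Phi> g x) * complex_of_real (r x)"
      using eventually_ge_at_top[of "\<bar>x\<bar>"] by eventually_elim (auto simp: indicator_def)
  qed
  show "\<forall>\<^sub>F k in at_top. AE x in lebesgue.
      norm (indicator {-k..k} x *\<^sub>R (\<Phi> f x * cnj (\<Phi> g x) * complex_of_real (r x)))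
      \<le> norm (\<Phi> f x * cnj (\<Phi> g x) * complex_of_real (r x))"
    by (intro always_eventually allI AE_I2) (auto simp: indicator_def)
qed

lemma t_indef_fun_eq:
  assumes "f \<in> dom_t_fun r \<alpha>" and "g \<in> dom_t_fun r \<alpha>"
  shows "t_indef_fun r f g = (LINT x|lebesgue. \<Phi> f x * cnj (\<Phi> g x) * complex_of_real (r x))"
  unfolding t_indef_fun_def using tendsto_truncated_integral[OF assms] by (intro tendsto_Lim) auto

end

section \<open>The space of classes\<close>

text \<open>The relation that forms the classes, restated in terms of Lebesgue measure so that it combines
  with the conditions on \<open>r\<close>.\<close>

definition r_eq :: "(real \<Rightarrow> real) \<Rightarrow> (real \<Rightarrow> complex) \<Rightarrow> (real \<Rightarrow> complex) \<Rightarrow> bool"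
  where "r_eq r f g \<longleftrightarrow> (AE x in lebesgue. r x \<noteq> 0 \<longrightarrow> f x = g x)"

lemma r_eq_sym: "r_eq r f g \<Longrightarrow> r_eq r g f"
  unfolding r_eq_def by (auto elim: eventually_mono)

lemma r_eq_linear:
  "r_eq r f f' \<Longrightarrow> r_eq r g g' \<Longrightarrow> r_eq r (\<lambda>x. a * f x + b * g x) (\<lambda>x. a * f' x + b * g' x)"
  unfolding r_eq_def by (auto elim: eventually_elim2)

lemma r_eq_add: "r_eq r f f' \<Longrightarrow> r_eq r g g' \<Longrightarrow> r_eq r (\<lambda>x. f x + g x) (\<lambda>x. f' x + g' x)"
  using r_eq_linear[of r f f' g g' 1 1] by simp

lemma r_eq_mult: "r_eq r f f' \<Longrightarrow> r_eq r (\<lambda>x. c * f x) (\<lambda>x. c * f' x)"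
  using r_eq_linear[of r f f' f f' c 0] by simp

lemma ae_class_eq_iff:
  assumes r: "r \<in> borel_measurable lebesgue"
    and f: "f \<in> borel_measurable lebesgue" and g: "g \<in> borel_measurable lebesgue"
  shows "ae_class r f = ae_class r g \<longleftrightarrow> r_eq r f g"
proof -
  have "ae_class r f = ae_class r g \<longleftrightarrow> (f, g) \<in> ae_eq r"
    unfolding ae_class_def by (rule eq_equiv_class_iff[OF equiv_ae_eq f g])
  also have "\<dots> \<longleftrightarrow> r_eq r f g"
    using r f g by (simp add: ae_eq_def r_eq_def AE_density)
  finally show ?thesis .
qed

lemma rep_ae_class:
  assumes r: "r \<in> borel_measurable lebesgue" and f: "f \<in> borel_measurable lebesgue"
  shows "rep (ae_class r f) \<in> borel_measurable lebesgue" and "r_eq r (rep (ae_class r f)) f"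
proof -
  have "f \<in> ae_class r f"
    unfolding ae_class_def by (rule equiv_class_self[OF equiv_ae_eq f])
  then have "rep (ae_class r f) \<in> ae_class r f" unfolding rep_def by (rule someI[where P = "\<lambda>g. g \<in> ae_class r f"])
  then have *: "(f, rep (ae_class r f)) \<in> ae_eq r" by (simp add: ae_class_def)
  show m: "rep (ae_class r f) \<in> borel_measurable lebesgue" using * unfolding ae_eq_def by blast
  have "ae_class r f = ae_class r (rep (ae_class r f))"
    using * unfolding ae_class_def by (rule equiv_class_eq[OF equiv_ae_eq])
  then have "r_eq r f (rep (ae_class r f))" by (rule iffD1[OF ae_class_eq_iff[OF r f m]])
  then show "r_eq r (rep (ae_class r f)) f" by (rule r_eq_sym)
qed

lemma carrier_class_space: "carrier (class_space r D) = ae_class r ` D"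
  by (auto simp: class_space_def quotient_def ae_class_def)

text \<open>The set \<open>D\<close> is any linear space of measurable functions. An operation on classes may compute
  with representatives outside \<open>D\<close>, but the resulting class has a member in \<open>D\<close>.\<close>

locale class_module =
  fixes r :: "real \<Rightarrow> real" and D :: "(real \<Rightarrow> complex) set"
  assumes r: "r \<in> borel_measurable lebesgue"
    and D_measurable: "f \<in> D \<Longrightarrow> f \<in> borel_measurable lebesgue"
    and D_zero: "(\<lambda>x. 0) \<in> D"
    and D_linear: "f \<in> D \<Longrightarrow> g \<in> D \<Longrightarrow> (\<lambda>x. a * f x + b * g x) \<in> D"
begin

lemma D_add: "f \<in> D \<Longrightarrow> g \<in> D \<Longrightarrow> (\<lambda>x. f x + g x) \<in> D"
  and D_mult: "f \<in> D \<Longrightarrow> (\<lambda>x. c * f x) \<in> D"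
  and D_uminus: "f \<in> D \<Longrightarrow> (\<lambda>x. - f x) \<in> D"
  and D_diff: "f \<in> D \<Longrightarrow> g \<in> D \<Longrightarrow> (\<lambda>x. f x - g x) \<in> D"
  using D_linear[of f g 1 1] D_linear[of f f c 0] D_linear[of f f "-1" 0] D_linear[of f g 1 "-1"]
  by simp_all

lemma class_eq_iff: "f \<in> D \<Longrightarrow> g \<in> D \<Longrightarrow> ae_class r f = ae_class r g \<longleftrightarrow> r_eq r f g"
  by (intro ae_class_eq_iff r D_measurable)

lemma class_add:
  assumes f: "f \<in> D" and g: "g \<in> D"
  shows "ae_class r f \<oplus>\<^bsub>class_space r D\<^esub> ae_class r g = ae_class r (\<lambda>x. f x + g x)"
proof -
  note m = D_measurable[OF f] D_measurable[OF g]
  have "ae_class r (\<lambda>x. rep (ae_class r f) x + rep (ae_class r g) x) = ae_class r (\<lambda>x. f x + g x)"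
  proof (rule iffD2[OF ae_class_eq_iff[OF r]])
    show "r_eq r (\<lambda>x. rep (ae_class r f) x + rep (ae_class r g) x) (\<lambda>x. f x + g x)"
      by (intro r_eq_add rep_ae_class r m)
  qed (intro borel_measurable_add rep_ae_class(1) r m)+
  then show ?thesis by (simp add: class_space_def)
qed

lemma class_smult:
  assumes f: "f \<in> D"
  shows "c \<odot>\<^bsub>class_space r D\<^esub> ae_class r f = ae_class r (\<lambda>x. c * f x)"
proof -
  note m = D_measurable[OF f]
  have "ae_class r (\<lambda>x. c * rep (ae_class r f) x) = ae_class r (\<lambda>x. c * f x)"
  proof (rule iffD2[OF ae_class_eq_iff[OF r]])
    show "r_eq r (\<lambda>x. c * rep (ae_class r f) x) (\<lambda>x. c * f x)"
      by (intro r_eq_mult rep_ae_class r m)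
  qed (intro borel_measurable_times borel_measurable_const rep_ae_class(1) r m)+
  then show ?thesis by (simp add: class_space_def)
qed

lemma class_zero: "\<zero>\<^bsub>class_space r D\<^esub> = ae_class r (\<lambda>x. 0)"
  by (simp add: class_space_def)

lemma module_class_space: "module complex_ring (class_space r D)"
proof (rule moduleI)
  show "cring complex_ring" by (rule cring_from_type_algebra)
  show "abelian_group (class_space r D)"
  proof (rule abelian_groupI)
    fix F assume "F \<in> carrier (class_space r D)"
    then obtain f where f: "f \<in> D" "F = ae_class r f" by (auto simp: carrier_class_space)
    then have "ae_class r (\<lambda>x. - f x) \<oplus>\<^bsub>class_space r D\<^esub> F = \<zero>\<^bsub>class_space r D\<^esub>"
      by (simp add: class_add D_uminus class_zero)
    then show "\<exists>G\<in>carrier (class_space r D). G \<oplus>\<^bsub>class_space r D\<^esub> F = \<zero>\<^bsub>class_space r D\<^esub>"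
      using D_uminus[OF f(1)] by (auto simp: carrier_class_space)
  qed (auto simp: carrier_class_space class_add class_zero D_add D_zero ac_simps)
qed (auto simp: carrier_class_space class_add class_smult D_add D_mult algebra_simps)

sublocale module complex_ring "class_space r D"
  by (rule module_class_space)

lemma class_uminus:
  assumes f: "f \<in> D"
  shows "\<ominus>\<^bsub>class_space r D\<^esub> ae_class r f = ae_class r (\<lambda>x. - f x)"
  by (rule minus_equality) (use f in \<open>auto simp: class_add class_zero D_uminus carrier_class_space\<close>)

lemma class_diff:
  assumes "f \<in> D" "g \<in> D"
  shows "ae_class r f \<ominus>\<^bsub>class_space r D\<^esub> ae_class r g = ae_class r (\<lambda>x. f x - g x)"
  using assms by (simp add: a_minus_def class_uminus class_add D_uminus)

end

context odd_weight
begin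

text \<open>Since \<open>r\<close> is odd, its zeros are symmetric up to a null set. Hence the even and the odd part
  of a class are well defined.\<close>

lemma r_eq_reflect:
  assumes "r_eq r f g"
  shows "AE x in lebesgue. r x \<noteq> 0 \<longrightarrow> f x = g x \<and> f (- x) = g (- x)"
  using assms[unfolded r_eq_def] AE_reflect[OF assms[unfolded r_eq_def]] odd
  by eventually_elim auto

lemma r_eq_twist: "r_eq r f g \<Longrightarrow> r_eq r (twist s f) (twist s g)"
  unfolding r_eq_def[of r "twist s f"]
  by (drule r_eq_reflect) (auto simp: twist_def even_part_def odd_part_def elim: eventually_mono)

lemma r_eq_S: "r_eq r f g \<Longrightarrow> r_eq r (S_fun \<alpha> f) (S_fun \<alpha> g)"
  unfolding r_eq_def[of r "S_fun \<alpha> f"]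
  by (drule r_eq_reflect) (auto simp: S_fun_def elim: eventually_mono)

lemma L2_weight_r_eq:
  assumes f: "f \<in> L2_weight r" and g: "g \<in> borel_measurable lebesgue" and eq: "r_eq r f g"
  shows "g \<in> L2_weight r"
proof (rule L2_weight_dominated[OF g r_measurable f f, where C = 1])
  show "AE x in lebesgue. (cmod (g x))\<^sup>2 * \<bar>r x\<bar> \<le> 1 * ((cmod (f x))\<^sup>2 * \<bar>r x\<bar> + (cmod (f x))\<^sup>2 * \<bar>r x\<bar>)"
    using eq unfolding r_eq_def
  proof eventually_elim
    case (elim x)
    then show ?case by (cases "r x = 0") auto
  qed
qed

lemma dom_r_eq:
  assumes f: "f \<in> dom_t_fun r \<alpha>" and g: "g \<in> borel_measurable lebesgue" and eq: "r_eq r f g"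
  shows "g \<in> dom_t_fun r \<alpha>"
  unfolding dom_t_fun_iff
  using g L2_weight_r_eq[OF dom_\<Phi>[OF f] _ r_eq_twist[OF eq]] by auto

lemma t_fun_r_eq:
  assumes f: "f \<in> dom_t_fun r \<alpha>" "f' \<in> dom_t_fun r \<alpha>" "r_eq r f f'"
    and g: "g \<in> dom_t_fun r \<alpha>" "g' \<in> dom_t_fun r \<alpha>" "r_eq r g g'"
  shows "t_fun r \<alpha> f g = t_fun r \<alpha> f' g'"
proof -
  have "(LINT x|lebesgue. \<Phi> f x * cnj (\<Phi> g x) * complex_of_real \<bar>r x\<bar>)
      = (LINT x|lebesgue. \<Phi> f' x * cnj (\<Phi> g' x) * complex_of_real \<bar>r x\<bar>)"
  proof (rule integral_cong_AE)
    show "AE x in lebesgue. \<Phi> f x * cnj (\<Phi> g x) * complex_of_real \<bar>r x\<bar>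
        = \<Phi> f' x * cnj (\<Phi> g' x) * complex_of_real \<bar>r x\<bar>"
      using r_eq_twist[OF f(3), of "half_weight \<alpha>", unfolded r_eq_def]
        r_eq_twist[OF g(3), of "half_weight \<alpha>", unfolded r_eq_def]
    proof eventually_elim
      case (elim x)
      then show ?case by (cases "r x = 0") auto
    qed
  qed (intro borel_measurable_integrable \<Phi>_product_integrable(2) f(1,2) g(1,2))+
  then show ?thesis using f g by (simp add: t_fun_eq)
qed

lemma \<Phi>_linear: "\<Phi> (\<lambda>x. a * f x + b * g x) x = a * \<Phi> f x + b * \<Phi> g x"
  by (rule twist_linear)

lemma \<Phi>_diff: "\<Phi> (\<lambda>x. f x - g x) x = \<Phi> f x - \<Phi> g x"
  using \<Phi>_linear[of 1 f "-1" g x] by simp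

lemma L2_weight_linear:
  assumes "w \<in> borel_measurable lebesgue" "f \<in> L2_weight w" "g \<in> L2_weight w"
  shows "(\<lambda>x. a * f x + b * g x) \<in> L2_weight w"
proof -
  have "(\<lambda>x. c * h x) \<in> L2_weight w" if "h \<in> L2_weight w" for c h
    by (rule L2_weight_mult_bounded[OF assms(1) that borel_measurable_const order_refl])
  then show ?thesis using assms by (intro L2_weight_add) auto
qed

lemma dom_linear:
  assumes "f \<in> dom_t_fun r \<alpha>" "g \<in> dom_t_fun r \<alpha>"
  shows "(\<lambda>x. a * f x + b * g x) \<in> dom_t_fun r \<alpha>"
proof -
  have "\<Phi> (\<lambda>x. a * f x + b * g x) = (\<lambda>x. a * \<Phi> f x + b * \<Phi> g x)" by (rule ext) (rule \<Phi>_linear)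
  moreover have "(\<lambda>x. a * f x + b * g x) \<in> borel_measurable lebesgue"
    by (intro borel_measurable_add borel_measurable_times borel_measurable_const dom_measurable assms)
  ultimately show ?thesis
    unfolding dom_t_fun_iff
    using L2_weight_linear[OF r_measurable dom_\<Phi>[OF assms(1)] dom_\<Phi>[OF assms(2)], of a b]
    by (simp only:)
qed

lemma zero_dom: "(\<lambda>x. 0) \<in> dom_t_fun r \<alpha>"
proof -
  have "\<Phi> (\<lambda>x. 0) = (\<lambda>x. 0)" using \<Phi>_linear[of 0 "\<lambda>x. 0" 0 "\<lambda>x. 0"] by (intro ext) simp
  then show ?thesis by (simp add: dom_t_fun_iff L2_weight_def)
qed

sublocale dom: class_module r "dom_t_fun r \<alpha>"
  by unfold_locales (auto simp: dom_measurable zero_dom dom_linear)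

lemma dom_t_eq: "dom_t r \<alpha> = class_space r (dom_t_fun r \<alpha>)"
  by (simp add: dom_t_def)

lemma rep_dom:
  assumes "f \<in> dom_t_fun r \<alpha>"
  shows "rep (ae_class r f) \<in> dom_t_fun r \<alpha>" and "r_eq r (rep (ae_class r f)) f"
proof -
  note m = rep_ae_class[OF r_measurable dom_measurable[OF assms]]
  show "r_eq r (rep (ae_class r f)) f" by (rule m)
  show "rep (ae_class r f) \<in> dom_t_fun r \<alpha>" using dom_r_eq[OF assms m(1) r_eq_sym[OF m(2)]] .
qed

lemma t_form_class:
  assumes "f \<in> dom_t_fun r \<alpha>" "g \<in> dom_t_fun r \<alpha>"
  shows "t_form r \<alpha> (ae_class r f) (ae_class r g) = t_fun r \<alpha> f g"
  unfolding t_form_def using assms by (intro t_fun_r_eq rep_dom)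

lemma t_fun_linear_left:
  assumes f: "f \<in> dom_t_fun r \<alpha>" and g: "g \<in> dom_t_fun r \<alpha>" and h: "h \<in> dom_t_fun r \<alpha>"
  shows "t_fun r \<alpha> (\<lambda>x. a * f x + b * g x) h = a * t_fun r \<alpha> f h + b * t_fun r \<alpha> g h"
proof -
  note int = \<Phi>_product_integrable(2)[OF f h] \<Phi>_product_integrable(2)[OF g h]
  have "t_fun r \<alpha> (\<lambda>x. a * f x + b * g x) h
      = (LINT x|lebesgue. a * (\<Phi> f x * cnj (\<Phi> h x) * complex_of_real \<bar>r x\<bar>)
        + b * (\<Phi> g x * cnj (\<Phi> h x) * complex_of_real \<bar>r x\<bar>))"
    unfolding t_fun_eq[OF dom_linear[OF f g] h] \<Phi>_linear by (simp add: algebra_simps)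
  also have "\<dots> = a * t_fun r \<alpha> f h + b * t_fun r \<alpha> g h"
    using int by (simp add: t_fun_eq f g h)
  finally show ?thesis .
qed

lemma t_fun_sym:
  assumes "f \<in> dom_t_fun r \<alpha>" "g \<in> dom_t_fun r \<alpha>"
  shows "t_fun r \<alpha> g f = cnj (t_fun r \<alpha> f g)"
  unfolding t_fun_eq[OF assms] t_fun_eq[OF assms(2,1)]
  by (subst Bochner_Integration.integral_cnj[symmetric]) (simp add: mult.commute)

lemma t_fun_self:
  assumes "f \<in> dom_t_fun r \<alpha>"
  shows "Re (t_fun r \<alpha> f f) = (LINT x|lebesgue. (cmod (\<Phi> f x))\<^sup>2 * \<bar>r x\<bar>)"
proof -
  have "t_fun r \<alpha> f f = (LINT x|lebesgue. complex_of_real ((cmod (\<Phi> f x))\<^sup>2 * \<bar>r x\<bar>))"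
    unfolding t_fun_eq[OF assms assms] by (simp add: complex_norm_square[symmetric])
  then show ?thesis by (simp only: integral_complex_of_real Re_complex_of_real)
qed

text \<open>\<open>\<Phi> f\<close> vanishes where \<open>r\<close> does not, and \<open>\<Psi>\<close> brings \<open>f\<close> back.\<close>

lemma t_fun_self_eq_0:
  assumes f: "f \<in> dom_t_fun r \<alpha>" and 0: "Re (t_fun r \<alpha> f f) = 0"
  shows "r_eq r f (\<lambda>x. 0)"
proof -
  have "integrable lebesgue (\<lambda>x. (cmod (\<Phi> f x))\<^sup>2 * \<bar>r x\<bar>)"
    using dom_\<Phi>[OF f] by (simp add: L2_weight_def)
  then have "AE x in lebesgue. (cmod (\<Phi> f x))\<^sup>2 * \<bar>r x\<bar> = 0"
    using 0 unfolding t_fun_self[OF f] by (subst (asm) integral_nonneg_eq_0_iff_AE) auto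
  then have "r_eq r (\<Phi> f) (\<lambda>x. 0)"
    unfolding r_eq_def by eventually_elim auto
  then have "r_eq r (\<Psi> (\<Phi> f)) (\<Psi> (\<lambda>x. 0))" by (rule r_eq_twist)
  moreover have "\<Psi> (\<Phi> f) = f" by (rule ext) (rule \<Psi>_\<Phi>)
  moreover have "\<Psi> (\<lambda>x. 0) = (\<lambda>x. 0)" by (rule ext) (simp add: twist_def even_part_def odd_part_def)
  ultimately show ?thesis by simp
qed

lemma hermitian_t_form: "hermitian_form (dom_t r \<alpha>) (t_form r \<alpha>)"
  unfolding hermitian_form_def dom_t_eq
proof (intro conjI ballI allI)
  fix F G H c
  assume "F \<in> carrier (class_space r (dom_t_fun r \<alpha>))" "G \<in> carrier (class_space r (dom_t_fun r \<alpha>))"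
  then obtain f g where f: "f \<in> dom_t_fun r \<alpha>" "F = ae_class r f"
    and g: "g \<in> dom_t_fun r \<alpha>" "G = ae_class r g"
    by (auto simp: carrier_class_space)
  show "t_form r \<alpha> (c \<odot>\<^bsub>class_space r (dom_t_fun r \<alpha>)\<^esub> F) G = c * t_form r \<alpha> F G"
    using t_fun_linear_left[OF f(1) f(1) g(1), of c 0]
    by (simp add: f g dom.class_smult t_form_class dom.D_mult)
  show "t_form r \<alpha> G F = cnj (t_form r \<alpha> F G)"
    using t_fun_sym[OF f(1) g(1)] by (simp add: f g t_form_class)
  assume "H \<in> carrier (class_space r (dom_t_fun r \<alpha>))"
  then obtain h where h: "h \<in> dom_t_fun r \<alpha>" "H = ae_class r h" by (auto simp: carrier_class_space)
  show "t_form r \<alpha> (F \<oplus>\<^bsub>class_space r (dom_t_fun r \<alpha>)\<^esub> G) H = t_form r \<alpha> F H + t_form r \<alpha> G H"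
    using t_fun_linear_left[OF f(1) g(1) h(1), of 1 1]
    by (simp add: f g h dom.class_add t_form_class dom.D_add)
qed

lemma ip_module_dom: "ip_module (dom_t r \<alpha>) (t_form r \<alpha>)"
proof (intro ip_module.intro ip_module_axioms.intro)
  show "module complex_ring (dom_t r \<alpha>)" unfolding dom_t_eq by (rule dom.module_class_space)
  show "hermitian_form (dom_t r \<alpha>) (t_form r \<alpha>)" by (rule hermitian_t_form)
  fix F assume F: "F \<in> carrier (dom_t r \<alpha>)" "F \<noteq> \<zero>\<^bsub>dom_t r \<alpha>\<^esub>"
  then obtain f where f: "f \<in> dom_t_fun r \<alpha>" "F = ae_class r f" by (auto simp: carrier_class_space dom_t_eq)
  have "\<not> r_eq r f (\<lambda>x. 0)"
    using F(2) f dom.class_eq_iff[OF f(1) zero_dom] by (simp add: dom_t_eq dom.class_zero)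
  then have "Re (t_fun r \<alpha> f f) \<noteq> 0" using t_fun_self_eq_0[OF f(1)] by blast
  moreover have "0 \<le> Re (t_fun r \<alpha> f f)" unfolding t_fun_self[OF f(1)] by simp
  ultimately show "0 < Re (t_form r \<alpha> F F)" by (simp add: f t_form_class)
qed

sublocale form: ip_module "dom_t r \<alpha>" "t_form r \<alpha>"
  by (rule ip_module_dom)

lemma ip_dist_class:
  assumes f: "f \<in> dom_t_fun r \<alpha>" and g: "g \<in> dom_t_fun r \<alpha>"
  shows "ip_dist (dom_t r \<alpha>) (t_form r \<alpha>) (ae_class r f) (ae_class r g)
    = sqrt (LINT x|lebesgue. (cmod (\<Phi> f x - \<Phi> g x))\<^sup>2 * \<bar>r x\<bar>)"
  using f g
  by (simp add: ip_dist_def dom_t_eq carrier_class_space dom.class_diff t_form_class dom.D_diff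
      t_fun_self \<Phi>_diff)

section \<open>Completeness\<close>

lemma nn_integral_density_r:
  assumes [measurable]: "h \<in> borel_measurable lebesgue"
  shows "(\<integral>\<^sup>+x. ennreal ((cmod (h x))\<^sup>2) \<partial>density lebesgue (\<lambda>x. ennreal \<bar>r x\<bar>))
    = (\<integral>\<^sup>+x. ennreal ((cmod (h x))\<^sup>2 * \<bar>r x\<bar>) \<partial>lebesgue)"
  by (subst nn_integral_density) (auto simp: ennreal_mult mult.commute)

lemma nn_integral_L2:
  assumes "h \<in> L2_weight r"
  shows "(\<integral>\<^sup>+x. ennreal ((cmod (h x))\<^sup>2) \<partial>density lebesgue (\<lambda>x. ennreal \<bar>r x\<bar>))
    = ennreal (LINT x|lebesgue. (cmod (h x))\<^sup>2 * \<bar>r x\<bar>)"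
  unfolding nn_integral_density_r[OF L2_weight_measurable[OF assms]]
  using assms by (intro nn_integral_eq_integral) (auto simp: L2_weight_def)

lemma L2_weight_if_nn_integral:
  assumes h: "h \<in> borel_measurable lebesgue"
    and le: "(\<integral>\<^sup>+x. ennreal ((cmod (h x))\<^sup>2) \<partial>density lebesgue (\<lambda>x. ennreal \<bar>r x\<bar>)) \<le> ennreal e"
  shows "h \<in> L2_weight r"
proof -
  have "(\<lambda>x. (cmod (h x))\<^sup>2 * \<bar>r x\<bar>) \<in> borel_measurable lebesgue" using h by measurable
  moreover have "(\<integral>\<^sup>+x. ennreal ((cmod (h x))\<^sup>2 * \<bar>r x\<bar>) \<partial>lebesgue) < \<infinity>"
    using le unfolding nn_integral_density_r[OF h] by (rule le_less_trans) simp
  ultimately have "integrable lebesgue (\<lambda>x. (cmod (h x))\<^sup>2 * \<bar>r x\<bar>)"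
    by (intro integrableI_nonneg) auto
  then show ?thesis using h by (simp add: L2_weight_def)
qed

lemma L2_weight_diff: "f \<in> L2_weight r \<Longrightarrow> g \<in> L2_weight r \<Longrightarrow> (\<lambda>x. f x - g x) \<in> L2_weight r"
  using L2_weight_linear[OF r_measurable, of f g 1 "-1"] by simp

text \<open>Apply \<open>\<Phi>\<close> to a Cauchy sequence, take the limit \<open>g\<close> of the images in the weighted space, and
  return to the form domain by \<open>\<Psi> g\<close>.\<close>

lemma complete_dom: "form.ip.mcomplete"
  unfolding form.ip.mcomplete_def
proof (intro allI impI)
  fix \<sigma> assume cauchy: "form.ip.MCauchy \<sigma>"
  then have "\<sigma> n \<in> carrier (dom_t r \<alpha>)" for n unfolding form.ip.MCauchy_def by auto
  then have "\<forall>n. \<exists>f. f \<in> dom_t_fun r \<alpha> \<and> \<sigma> n = ae_class r f"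
    unfolding dom_t_eq carrier_class_space by blast
  then obtain f where f: "\<And>n. f n \<in> dom_t_fun r \<alpha>" and \<sigma>: "\<And>n. \<sigma> n = ae_class r (f n)" by metis
  let ?M = "density lebesgue (\<lambda>x. ennreal \<bar>r x\<bar>)"
  let ?h = "\<lambda>n. \<Phi> (f n)"
  have h: "?h n \<in> L2_weight r" for n using dom_\<Phi>[OF f] .
  have nn: "(\<integral>\<^sup>+x. ennreal ((cmod (?h m x - ?h n x))\<^sup>2) \<partial>?M)
      = ennreal ((ip_dist (dom_t r \<alpha>) (t_form r \<alpha>) (\<sigma> m) (\<sigma> n))\<^sup>2)" for m n
    unfolding \<sigma> ip_dist_class[OF f f] nn_integral_L2[OF L2_weight_diff[OF h h]] by simp
  have L2_cauchy: "\<exists>N. \<forall>m\<ge>N. \<forall>n\<ge>N. (\<integral>\<^sup>+x. ennreal ((cmod (?h m x - ?h n x))\<^sup>2) \<partial>?M) \<le> ennreal e"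
    if e: "e > 0" for e
  proof -
    obtain N where N: "\<And>m n. N \<le> m \<Longrightarrow> N \<le> n \<Longrightarrow> ip_dist (dom_t r \<alpha>) (t_form r \<alpha>) (\<sigma> m) (\<sigma> n) < sqrt e"
      using cauchy e unfolding form.ip.MCauchy_def by (metis real_sqrt_gt_zero)
    have "(ip_dist (dom_t r \<alpha>) (t_form r \<alpha>) (\<sigma> m) (\<sigma> n))\<^sup>2 \<le> e" if "m \<ge> N" "n \<ge> N" for m n
      using N[OF that] e power_mono[of _ "sqrt e" 2] by (metis form.ip.nonneg less_imp_le real_sqrt_pow2)
    then show ?thesis unfolding nn by (intro exI[of _ N] allI impI ennreal_leI)
  qed
  have h_measurable: "?h n \<in> borel_measurable ?M" for n using L2_weight_measurable[OF h] by simp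
  obtain g where g: "g \<in> borel_measurable ?M"
    and lim: "\<And>e::real. e > 0 \<Longrightarrow>
      \<exists>N. \<forall>n\<ge>N. (\<integral>\<^sup>+x. ennreal ((cmod (?h n x - g x))\<^sup>2) \<partial>?M) \<le> ennreal e"
    by (rule riesz_fischer[OF h_measurable L2_cauchy]) (assumption, rule that, assumption, blast)
  have gm: "g \<in> borel_measurable lebesgue" using g by simp
  obtain N where "(\<integral>\<^sup>+x. ennreal ((cmod (?h N x - g x))\<^sup>2) \<partial>?M) \<le> ennreal 1" using lim[of 1] by auto
  then have "(\<lambda>x. ?h N x - g x) \<in> L2_weight r"
    by (rule L2_weight_if_nn_integral[rotated]) (use gm L2_weight_measurable[OF h] in measurable)
  then have gL: "g \<in> L2_weight r" using L2_weight_diff[OF h[of N]] by force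
  have \<Phi>g: "\<Phi> (\<Psi> g) = g" by (rule ext) (rule \<Phi>_\<Psi>)
  have dom: "\<Psi> g \<in> dom_t_fun r \<alpha>" unfolding dom_t_fun_iff \<Phi>g using gL gm by simp
  have "limitin form.ip.mtopology \<sigma> (ae_class r (\<Psi> g)) sequentially"
    unfolding form.ip.limit_metric_sequentially
  proof (intro conjI allI impI)
    show "ae_class r (\<Psi> g) \<in> carrier (dom_t r \<alpha>)" using dom by (simp add: dom_t_eq carrier_class_space)
    fix e :: real assume e: "e > 0"
    then obtain N where N: "\<And>n. n \<ge> N \<Longrightarrow>
        (\<integral>\<^sup>+x. ennreal ((cmod (?h n x - g x))\<^sup>2) \<partial>?M) \<le> ennreal ((e / 2)\<^sup>2)"
      using lim[of "(e / 2)\<^sup>2"] by auto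
    have "ip_dist (dom_t r \<alpha>) (t_form r \<alpha>) (\<sigma> n) (ae_class r (\<Psi> g)) < e" if "n \<ge> N" for n
    proof -
      have "(LINT x|lebesgue. (cmod (?h n x - g x))\<^sup>2 * \<bar>r x\<bar>) \<le> (e / 2)\<^sup>2"
        using N[OF that] unfolding nn_integral_L2[OF L2_weight_diff[OF h gL]] by simp
      then have "sqrt (LINT x|lebesgue. (cmod (?h n x - g x))\<^sup>2 * \<bar>r x\<bar>) \<le> e / 2"
        using e by (intro real_le_lsqrt) auto
      then show ?thesis using e unfolding \<sigma> ip_dist_class[OF f dom] \<Phi>g by simp
    qed
    then show "\<exists>N. \<forall>n\<ge>N. \<sigma> n \<in> carrier (dom_t r \<alpha>) \<and>
        ip_dist (dom_t r \<alpha>) (t_form r \<alpha>) (\<sigma> n) (ae_class r (\<Psi> g)) < e"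
      using f by (auto simp: \<sigma> dom_t_eq carrier_class_space)
  qed
  then show "\<exists>F. limitin form.ip.mtopology \<sigma> F sequentially" ..
qed

end

section \<open>The fundamental symmetry\<close>

lemma S_fun_measurable:
  assumes [measurable]: "f \<in> borel_measurable lebesgue"
  shows "S_fun \<alpha> f \<in> borel_measurable lebesgue"
proof -
  have [measurable]: "(\<lambda>x::real. sqrt (\<bar>x\<bar> powr \<alpha> + 1)) \<in> borel_measurable lebesgue"
    by (intro measurable_completion) measurable
  show ?thesis unfolding S_fun_def[abs_def] by measurable
qed

lemma S_fun_linear: "S_fun \<alpha> (\<lambda>x. a * f x + b * g x) x = a * S_fun \<alpha> f x + b * S_fun \<alpha> g x"
  by (simp add: S_fun_def algebra_simps)

context odd_weight
begin

text \<open>The even part of \<open>S_fun \<alpha> f\<close> is \<open>sgn x * growth \<alpha> x * odd_part f x\<close>, and its odd part is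
  \<open>sgn x * decay \<alpha> x * even_part f x\<close>. The factors of \<open>\<Phi>\<close> turn \<open>growth\<close> and \<open>decay\<close> into the
  factors that \<open>\<Phi> f\<close> has at the same parts.\<close>

lemma \<Phi>_S: "\<Phi> (S_fun \<alpha> f) x = complex_of_real (sgn x) * \<Phi> f x"
proof -
  let ?s = "complex_of_real (half_weight \<alpha> x)" and ?\<sigma> = "complex_of_real (sgn x)"
  have s: "?s \<noteq> 0" using half_weight_pos[of \<alpha> x] by simp
  have d: "complex_of_real (decay \<alpha> x) = ?s * ?s"
    by (simp add: half_weight_squared[symmetric] power2_eq_square)
  have g: "complex_of_real (growth \<alpha> x) = 1 / ?s / ?s"
    by (simp add: half_weight_inverse_squared[symmetric] power2_eq_square)
  have "even_part (S_fun \<alpha> f) x = ?\<sigma> * (complex_of_real (growth \<alpha> x) * odd_part f x)"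
    by (simp add: even_part_def odd_part_def S_fun_def growth_def field_simps)
  moreover have "odd_part (S_fun \<alpha> f) x = ?\<sigma> * (complex_of_real (decay \<alpha> x) * even_part f x)"
    by (simp add: even_part_def odd_part_def S_fun_def decay_def field_simps)
  ultimately show ?thesis
    using s unfolding twist_def d g by (simp add: field_simps)
qed

text \<open>This is the square of multiplication by \<open>sgn x\<close>, transported by \<open>\<Psi>\<close>. It is the identity
  except at 0.\<close>

lemma S_S: "S_fun \<alpha> (S_fun \<alpha> f) x = complex_of_real ((sgn x)\<^sup>2) * f x"
proof -
  have "\<Phi> (S_fun \<alpha> (S_fun \<alpha> f)) = (\<lambda>x. complex_of_real ((sgn x)\<^sup>2) * \<Phi> f x)"
    by (rule ext) (auto simp: \<Phi>_S power2_eq_square sgn_if)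
  then have "\<Psi> (\<Phi> (S_fun \<alpha> (S_fun \<alpha> f))) x = \<Psi> (\<lambda>x. complex_of_real ((sgn x)\<^sup>2) * \<Phi> f x) x"
    by (simp only:)
  also have "\<dots> = complex_of_real ((sgn x)\<^sup>2) * \<Psi> (\<Phi> f) x"
    by (rule twist_mult_even) (simp add: sgn_minus)
  finally show ?thesis unfolding \<Psi>_\<Phi> .
qed

lemma r_eq_S_S: "r_eq r (S_fun \<alpha> (S_fun \<alpha> f)) f"
  unfolding r_eq_def S_S using AE_r
proof eventually_elim
  case (elim x)
  then show ?case using \<epsilon>_pos by (cases "x = 0") (auto simp: sgn_if)
qed

lemma S_dom:
  assumes f: "f \<in> dom_t_fun r \<alpha>" shows "S_fun \<alpha> f \<in> dom_t_fun r \<alpha>"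
proof -
  have "(\<lambda>x. complex_of_real (sgn x) * \<Phi> f x) \<in> L2_weight r"
  proof (rule L2_weight_mult_bounded[OF r_measurable dom_\<Phi>[OF f], where B = 1])
    show "(\<lambda>x. complex_of_real (sgn x)) \<in> borel_measurable lebesgue"
      by (rule borel_measurable_complex_of_real[OF sgn_measurable_lebesgue])
  qed (simp add: sgn_if)
  then have "\<Phi> (S_fun \<alpha> f) \<in> L2_weight r" unfolding \<Phi>_S[abs_def] .
  then show ?thesis
    unfolding dom_t_fun_iff using S_fun_measurable[OF dom_measurable[OF f]] by blast
qed

lemma t_fun_S_selfadjoint:
  assumes f: "f \<in> dom_t_fun r \<alpha>" and g: "g \<in> dom_t_fun r \<alpha>"
  shows "t_fun r \<alpha> (S_fun \<alpha> f) g = t_fun r \<alpha> f (S_fun \<alpha> g)"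
  unfolding t_fun_eq[OF S_dom[OF f] g] t_fun_eq[OF f S_dom[OF g]] \<Phi>_S by (simp add: ac_simps)

text \<open>Both sides are integrals of \<open>\<Phi> f x * cnj (\<Phi> g x)\<close>, and \<open>r x = sgn x * \<bar>r x\<bar>\<close> almost
  everywhere.\<close>

lemma t_indef_fun_eq_t_fun_S:
  assumes f: "f \<in> dom_t_fun r \<alpha>" and g: "g \<in> dom_t_fun r \<alpha>"
  shows "t_indef_fun r f g = t_fun r \<alpha> (S_fun \<alpha> f) g"
  unfolding t_indef_fun_eq[OF f g] t_fun_eq[OF S_dom[OF f] g]
proof (rule integral_cong_AE)
  show "AE x in lebesgue. \<Phi> f x * cnj (\<Phi> g x) * complex_of_real (r x)
      = \<Phi> (S_fun \<alpha> f) x * cnj (\<Phi> g x) * complex_of_real \<bar>r x\<bar>"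
    using AE_r
  proof eventually_elim
    case (elim x)
    have "complex_of_real (r x) = complex_of_real (sgn x) * complex_of_real \<bar>r x\<bar>"
      using elim by (metis of_real_mult)
    then show ?case unfolding \<Phi>_S by (simp only: ac_simps)
  qed
qed (intro borel_measurable_integrable \<Phi>_product_integrable f S_dom[OF f] g)+

lemma S_op_class:
  assumes f: "f \<in> borel_measurable lebesgue"
  shows "S_op r \<alpha> (ae_class r f) = ae_class r (S_fun \<alpha> f)"
  unfolding S_op_def
  by (rule iffD2[OF ae_class_eq_iff[OF r_measurable]])
    (intro S_fun_measurable rep_ae_class r_measurable f r_eq_S)+

lemma selfadjoint_involution_S: "selfadjoint_involution (dom_t r \<alpha>) (t_form r \<alpha>) (S_op r \<alpha>)"
proof (intro selfadjoint_involution.intro ip_module_dom selfadjoint_involution_axioms.intro)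
  fix F assume "F \<in> carrier (dom_t r \<alpha>)"
  then obtain f where f: "f \<in> dom_t_fun r \<alpha>" "F = ae_class r f" by (auto simp: carrier_class_space dom_t_eq)
  note S = S_op_class[OF dom_measurable]
  show "S_op r \<alpha> F \<in> carrier (dom_t r \<alpha>)"
    using S_dom[OF f(1)] by (auto simp: f S dom_t_eq carrier_class_space)
  show "S_op r \<alpha> (S_op r \<alpha> F) = F"
    using r_eq_S_S S_dom f by (simp add: S dom.class_eq_iff)
  have "S_fun \<alpha> (\<lambda>x. c * f x) = (\<lambda>x. c * S_fun \<alpha> f x)" for c
    using S_fun_linear[of \<alpha> c f 0 f] by (intro ext) simp
  then show "S_op r \<alpha> (c \<odot>\<^bsub>dom_t r \<alpha>\<^esub> F) = c \<odot>\<^bsub>dom_t r \<alpha>\<^esub> S_op r \<alpha> F" for c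
    using S_dom f by (simp add: S dom_t_eq dom.class_smult dom.D_mult)
  fix G assume "G \<in> carrier (dom_t r \<alpha>)"
  then obtain g where g: "g \<in> dom_t_fun r \<alpha>" "G = ae_class r g" by (auto simp: carrier_class_space dom_t_eq)
  have "S_fun \<alpha> (\<lambda>x. f x + g x) = (\<lambda>x. S_fun \<alpha> f x + S_fun \<alpha> g x)"
    using S_fun_linear[of \<alpha> 1 f 1 g] by (intro ext) simp
  then show "S_op r \<alpha> (F \<oplus>\<^bsub>dom_t r \<alpha>\<^esub> G) = S_op r \<alpha> F \<oplus>\<^bsub>dom_t r \<alpha>\<^esub> S_op r \<alpha> G"
    using S_dom f g by (simp add: S dom_t_eq dom.class_add dom.D_add)
  show "t_form r \<alpha> (S_op r \<alpha> F) G = t_form r \<alpha> F (S_op r \<alpha> G)"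
    using S_dom f g by (simp add: S t_form_class t_fun_S_selfadjoint)
qed

sublocale sym: selfadjoint_involution "dom_t r \<alpha>" "t_form r \<alpha>" "S_op r \<alpha>"
  by (rule selfadjoint_involution_S)

lemma t_indef_eq:
  assumes "F \<in> carrier (dom_t r \<alpha>)" "G \<in> carrier (dom_t r \<alpha>)"
  shows "t_indef r F G = t_form r \<alpha> (S_op r \<alpha> F) G"
proof -
  obtain f g where f: "f \<in> dom_t_fun r \<alpha>" "F = ae_class r f" and g: "g \<in> dom_t_fun r \<alpha>" "G = ae_class r g"
    using assms by (auto simp: carrier_class_space dom_t_eq)
  note rf = rep_dom[OF f(1)] and rg = rep_dom[OF g(1)]
  have "t_indef r F G = t_fun r \<alpha> (S_fun \<alpha> (rep (ae_class r f))) (rep (ae_class r g))"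
    unfolding t_indef_def f(2) g(2) by (rule t_indef_fun_eq_t_fun_S[OF rf(1) rg(1)])
  also have "\<dots> = t_fun r \<alpha> (S_fun \<alpha> f) g"
    by (intro t_fun_r_eq S_dom rf rg f g r_eq_S)
  also have "\<dots> = t_form r \<alpha> (S_op r \<alpha> F) G"
    using S_dom f g by (simp add: S_op_class[OF dom_measurable] t_form_class)
  finally show ?thesis .
qed

end

section \<open>Density of the functions with bounded support\<close>

definition cutoff :: "real \<Rightarrow> (real \<Rightarrow> complex) \<Rightarrow> real \<Rightarrow> complex"
  where "cutoff k f x = complex_of_real (indicator {-k..k} x) * f x"

lemma indicator_even: "indicator {-k..k} (- x) = (indicator {-k..k} x :: real)" for k x :: real
  by (auto simp: indicator_def)

context odd_weight
begin

lemma L2_r0_zero_outside: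
  assumes "f \<in> L2_r0_fun r"
  obtains k where "k > 0" and "AE x in lebesgue. k < \<bar>x\<bar> \<longrightarrow> f x = 0 \<and> f (- x) = 0"
proof -
  obtain k where k: "k > 0" and 0: "AE x in lebesgue. x \<in> UNIV - {-k..k} \<longrightarrow> f x = 0"
    using assms by (auto simp: L2_r0_fun_def)
  have "AE x in lebesgue. k < \<bar>x\<bar> \<longrightarrow> f x = 0 \<and> f (- x) = 0"
    using 0 AE_reflect[OF 0] by eventually_elim (auto simp: abs_if split: if_splits)
  then show thesis using that k by blast
qed

text \<open>On a bounded interval \<open>growth\<close> is bounded where \<open>r\<close> does not vanish. So an operator whose
  value at \<open>x\<close> is controlled by \<open>f x\<close>, \<open>f (- x)\<close> and \<open>growth \<alpha> x\<close> preserves square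
  integrability with bounded support. This applies to \<open>\<Phi>\<close> and to \<open>S_fun \<alpha>\<close>.\<close>

lemma L2_r0_bounded_operator:
  assumes f: "f \<in> L2_r0_fun r" and h: "h \<in> borel_measurable lebesgue"
    and bound: "\<And>x. (cmod (h x))\<^sup>2 \<le> B * (growth \<alpha> x)\<^sup>2 * ((cmod (f x))\<^sup>2 + (cmod (f (- x)))\<^sup>2)" and B: "0 \<le> B"
  shows "h \<in> L2_r0_fun r"
proof -
  obtain k where k: "k > 0" and 0: "AE x in lebesgue. k < \<bar>x\<bar> \<longrightarrow> f x = 0 \<and> f (- x) = 0"
    using L2_r0_zero_outside[OF f] .
  have f2: "f \<in> L2_weight r" using f by (simp add: L2_r0_fun_def)
  have h0: "h x = 0" if "f x = 0 \<and> f (- x) = 0" for x using bound[of x] that by simp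
  have "h \<in> L2_weight r"
  proof (rule L2_weight_dominated[OF h r_measurable f2 L2_weight_reflect[OF AE_abs_r_even r_measurable f2],
        where C = "B * (bound_const * k)\<^sup>2"])
    show "AE x in lebesgue. (cmod (h x))\<^sup>2 * \<bar>r x\<bar>
        \<le> B * (bound_const * k)\<^sup>2 * ((cmod (f x))\<^sup>2 * \<bar>r x\<bar> + (cmod (f (- x)))\<^sup>2 * \<bar>r x\<bar>)"
      using 0 AE_r
    proof eventually_elim
      case (elim x)
      show ?case
      proof (cases "r x = 0 \<or> k < \<bar>x\<bar>")
        case True
        then show ?thesis using elim h0 by auto
      next
        case False
        then have "growth \<alpha> x \<le> bound_const * \<bar>x\<bar>" using elim by (intro growth_le(2)) auto
        also have "\<dots> \<le> bound_const * k" using False bound_const_pos by (intro mult_left_mono) auto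
        finally have "(growth \<alpha> x)\<^sup>2 \<le> (bound_const * k)\<^sup>2" using growth_ge_1[of \<alpha> x] by (intro power_mono) auto
        then have "B * (growth \<alpha> x)\<^sup>2 * ((cmod (f x))\<^sup>2 + (cmod (f (- x)))\<^sup>2)
            \<le> B * (bound_const * k)\<^sup>2 * ((cmod (f x))\<^sup>2 + (cmod (f (- x)))\<^sup>2)"
          using B by (intro mult_right_mono mult_left_mono) auto
        then have "(cmod (h x))\<^sup>2 \<le> B * (bound_const * k)\<^sup>2 * ((cmod (f x))\<^sup>2 + (cmod (f (- x)))\<^sup>2)"
          using bound[of x] by linarith
        then have "(cmod (h x))\<^sup>2 * \<bar>r x\<bar> \<le> B * (bound_const * k)\<^sup>2 * ((cmod (f x))\<^sup>2 + (cmod (f (- x)))\<^sup>2) * \<bar>r x\<bar>"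
          by (rule mult_right_mono) simp
        then show ?thesis by (simp only: distrib_right mult.assoc)
      qed
    qed
  qed
  moreover have "AE x in lebesgue. x \<in> UNIV - {-k..k} \<longrightarrow> h x = 0"
    using 0
  proof eventually_elim
    case (elim x)
    have "k < \<bar>x\<bar>" if "x \<in> UNIV - {-k..k}" using that k by (auto simp: abs_if)
    then show ?case using elim h0 by blast
  qed
  ultimately show ?thesis using k by (auto simp: L2_r0_fun_def)
qed

lemma L2_r0_measurable: "f \<in> L2_r0_fun r \<Longrightarrow> f \<in> borel_measurable lebesgue"
  by (simp add: L2_r0_fun_def L2_weight_def)

lemma L2_r0_dom:
  assumes f: "f \<in> L2_r0_fun r" shows "f \<in> dom_t_fun r \<alpha>"
proof -
  have "\<Phi> f \<in> L2_r0_fun r"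
  proof (rule L2_r0_bounded_operator[OF f, where B = 1])
    show "\<Phi> f \<in> borel_measurable lebesgue" using L2_r0_measurable[OF f] by measurable
    fix x
    let ?e = "(cmod (even_part f x))\<^sup>2" and ?o = "(cmod (odd_part f x))\<^sup>2"
    have g: "growth \<alpha> x \<le> (growth \<alpha> x)\<^sup>2"
      using growth_ge_1[of \<alpha> x] by (intro self_le_power) auto
    have d: "decay \<alpha> x \<le> growth \<alpha> x" by (rule decay_le_growth)
    have "(cmod (\<Phi> f x))\<^sup>2 \<le> 2 * (decay \<alpha> x * ?e + growth \<alpha> x * ?o)"
      using \<Phi>_energy[of f x] by (metis add_increasing2 order_refl zero_le_power2)
    also have "\<dots> \<le> 2 * ((growth \<alpha> x)\<^sup>2 * ?e + (growth \<alpha> x)\<^sup>2 * ?o)"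
      using g d by (intro mult_left_mono add_mono mult_right_mono) auto
    also have "\<dots> = 1 * (growth \<alpha> x)\<^sup>2 * ((cmod (f x))\<^sup>2 + (cmod (f (- x)))\<^sup>2)"
      unfolding cmod_even_odd[symmetric] by (simp add: algebra_simps)
    finally show "(cmod (\<Phi> f x))\<^sup>2 \<le> 1 * (growth \<alpha> x)\<^sup>2 * ((cmod (f x))\<^sup>2 + (cmod (f (- x)))\<^sup>2)" .
  qed simp
  then show ?thesis using L2_r0_measurable[OF f] by (simp add: dom_t_fun_iff L2_r0_fun_def)
qed

lemma S_L2_r0:
  assumes f: "f \<in> L2_r0_fun r" shows "S_fun \<alpha> f \<in> L2_r0_fun r"
proof (rule L2_r0_bounded_operator[OF f S_fun_measurable[OF L2_r0_measurable[OF f]], where B = 2])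
  fix x
  define a b where "a = sqrt (\<bar>x\<bar> powr \<alpha> + 1)" and "b = sqrt (\<bar>x\<bar> powr \<alpha>)"
  have ab: "0 \<le> a" "0 \<le> b" "growth \<alpha> x = a + b" by (auto simp: a_def b_def growth_def)
  have "(cmod (S_fun \<alpha> f x))\<^sup>2 \<le> (cmod (complex_of_real a * f x + - (complex_of_real b * f (- x))))\<^sup>2"
    by (simp add: S_fun_def norm_mult power_mult_distrib a_def b_def sgn_if)
  also have "\<dots> \<le> 2 * ((cmod (complex_of_real a * f x))\<^sup>2 + (cmod (- (complex_of_real b * f (- x))))\<^sup>2)"
    by (rule cmod_add_squared_le)
  also have "\<dots> = 2 * (a\<^sup>2 * (cmod (f x))\<^sup>2 + b\<^sup>2 * (cmod (f (- x)))\<^sup>2)"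
    by (simp add: norm_mult power_mult_distrib)
  also have "\<dots> \<le> 2 * ((growth \<alpha> x)\<^sup>2 * (cmod (f x))\<^sup>2 + (growth \<alpha> x)\<^sup>2 * (cmod (f (- x)))\<^sup>2)"
    using ab by (intro mult_left_mono add_mono mult_right_mono power_mono) auto
  finally show "(cmod (S_fun \<alpha> f x))\<^sup>2 \<le> 2 * (growth \<alpha> x)\<^sup>2 * ((cmod (f x))\<^sup>2 + (cmod (f (- x)))\<^sup>2)"
    by (simp add: algebra_simps)
qed simp

lemma L2_r0_linear:
  assumes f: "f \<in> L2_r0_fun r" and g: "g \<in> L2_r0_fun r"
  shows "(\<lambda>x. a * f x + b * g x) \<in> L2_r0_fun r"
proof -
  obtain k where k: "k > 0" and 0: "AE x in lebesgue. k < \<bar>x\<bar> \<longrightarrow> f x = 0 \<and> f (- x) = 0"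
    using L2_r0_zero_outside[OF f] .
  obtain l where l: "l > 0" and 1: "AE x in lebesgue. l < \<bar>x\<bar> \<longrightarrow> g x = 0 \<and> g (- x) = 0"
    using L2_r0_zero_outside[OF g] .
  have "AE x in lebesgue. x \<in> UNIV - {-(k + l)..k + l} \<longrightarrow> a * f x + b * g x = 0"
    using 0 1
  proof eventually_elim
    case (elim x)
    show ?case
    proof
      assume "x \<in> UNIV - {-(k + l)..k + l}"
      then have "k < \<bar>x\<bar>" "l < \<bar>x\<bar>" using k l by (auto simp: abs_if)
      then show "a * f x + b * g x = 0" using elim by simp
    qed
  qed
  moreover have "(\<lambda>x. a * f x + b * g x) \<in> L2_weight r"
    by (rule L2_weight_linear[OF r_measurable]) (use f g in \<open>simp_all add: L2_r0_fun_def\<close>)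
  ultimately show ?thesis using k l by (auto simp: L2_r0_fun_def intro!: exI[of _ "k + l"])
qed

sublocale r0: class_module r "L2_r0_fun r"
proof
  show "(\<lambda>x. 0) \<in> L2_r0_fun r" by (auto simp: L2_r0_fun_def L2_weight_def intro: exI[of _ 1])
qed (auto simp: L2_r0_measurable L2_r0_linear)

lemma carrier_L2_r0: "carrier (L2_r0 r) = ae_class r ` L2_r0_fun r"
  by (simp add: L2_r0_def carrier_class_space)

lemma M_plus_eq: "M_plus r \<alpha> = {F \<in> carrier (L2_r0 r). S_op r \<alpha> F = F}"
proof -
  have "F \<ominus>\<^bsub>L2_r0 r\<^esub> S_op r \<alpha> F = \<zero>\<^bsub>L2_r0 r\<^esub> \<longleftrightarrow> S_op r \<alpha> F = F" if F: "F \<in> carrier (L2_r0 r)" for F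
  proof -
    obtain f where f: "f \<in> L2_r0_fun r" "F = ae_class r f" using F by (auto simp: carrier_L2_r0)
    then have "S_op r \<alpha> F \<in> carrier (L2_r0 r)"
      using S_L2_r0[OF f(1)] by (simp add: carrier_L2_r0 S_op_class L2_r0_measurable)
    then show ?thesis using F r0.diff_eq_zero_iff[of F "S_op r \<alpha> F"] unfolding L2_r0_def by auto
  qed
  then show ?thesis unfolding M_plus_def by blast
qed

text \<open>The negative is taken in the larger space, which is where the closure is formed.\<close>

lemma M_minus_eq: "M_minus r \<alpha> = {F \<in> carrier (L2_r0 r). S_op r \<alpha> F = \<ominus>\<^bsub>dom_t r \<alpha>\<^esub> F}"
proof -
  have "F \<oplus>\<^bsub>L2_r0 r\<^esub> S_op r \<alpha> F = \<zero>\<^bsub>L2_r0 r\<^esub> \<longleftrightarrow> S_op r \<alpha> F = \<ominus>\<^bsub>dom_t r \<alpha>\<^esub> F"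
    if F: "F \<in> carrier (L2_r0 r)" for F
  proof -
    obtain f where f: "f \<in> L2_r0_fun r" "F = ae_class r f" using F by (auto simp: carrier_L2_r0)
    note m = L2_r0_measurable[OF f(1)] and d = L2_r0_dom[OF f(1)]
    have "F \<oplus>\<^bsub>L2_r0 r\<^esub> S_op r \<alpha> F = \<zero>\<^bsub>L2_r0 r\<^esub>
        \<longleftrightarrow> ae_class r (\<lambda>x. f x + S_fun \<alpha> f x) = ae_class r (\<lambda>x. 0)"
      by (simp add: L2_r0_def f S_op_class m S_L2_r0 r0.class_add r0.class_zero)
    also have "\<dots> \<longleftrightarrow> r_eq r (\<lambda>x. f x + S_fun \<alpha> f x) (\<lambda>x. 0)"
      by (intro dom.class_eq_iff dom.D_add d S_dom zero_dom)
    also have "\<dots> \<longleftrightarrow> r_eq r (S_fun \<alpha> f) (\<lambda>x. - f x)"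
      unfolding r_eq_def by (simp add: add_eq_0_iff)
    also have "\<dots> \<longleftrightarrow> S_op r \<alpha> F = \<ominus>\<^bsub>dom_t r \<alpha>\<^esub> F"
      by (simp add: dom_t_eq f S_op_class m d dom.class_uminus dom.class_eq_iff S_dom dom.D_uminus)
    finally show ?thesis .
  qed
  then show ?thesis unfolding M_minus_def by blast
qed

lemma cutoff_L2_r0:
  assumes f: "f \<in> dom_t_fun r \<alpha>" and k: "k > 0" shows "cutoff k f \<in> L2_r0_fun r"
proof -
  have m: "cutoff k f \<in> borel_measurable lebesgue"
    unfolding cutoff_def[abs_def]
    by (intro borel_measurable_times borel_measurable_complex_of_real dom_measurable[OF f]
        indicator_Icc_measurable_lebesgue)
  have fe: "f \<in> L2_weight (eta r \<alpha>)" by (rule dom_in_L2_eta[OF f])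
  have "cutoff k f \<in> L2_weight r"
  proof (rule L2_weight_dominated[OF m r_measurable fe fe, where C = "bound_const * k"])
    show "AE x in lebesgue. (cmod (cutoff k f x))\<^sup>2 * \<bar>r x\<bar>
        \<le> bound_const * k * ((cmod (f x))\<^sup>2 * \<bar>eta r \<alpha> x\<bar> + (cmod (f x))\<^sup>2 * \<bar>eta r \<alpha> x\<bar>)"
      using AE_r
    proof eventually_elim
      case (elim x)
      let ?q = "(cmod (f x))\<^sup>2 * \<bar>r x\<bar>"
      have nn: "0 \<le> bound_const * k * ((cmod (f x))\<^sup>2 * \<bar>eta r \<alpha> x\<bar>)" using bound_const_pos k by simp
      show ?case
      proof (cases "r x \<noteq> 0 \<and> x \<in> {-k..k}")
        case True
        have "1 \<le> bound_const * \<bar>x\<bar> * decay \<alpha> x" using True elim by (intro one_le_decay) auto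
        also have "\<dots> \<le> bound_const * k * decay \<alpha> x"
          using True bound_const_pos decay_pos[of \<alpha> x] by (intro mult_right_mono mult_left_mono) auto
        finally have "1 * ?q \<le> bound_const * k * decay \<alpha> x * ?q" by (intro mult_right_mono) auto
        also have "\<dots> = bound_const * k * ((cmod (f x))\<^sup>2 * \<bar>eta r \<alpha> x\<bar>)"
          using decay_pos[of \<alpha> x] by (simp add: eta_eq abs_mult)
        finally have "?q \<le> bound_const * k * ((cmod (f x))\<^sup>2 * \<bar>eta r \<alpha> x\<bar>)" by simp
        moreover have "(cmod (cutoff k f x))\<^sup>2 * \<bar>r x\<bar> = ?q" using True by (simp add: cutoff_def)
        ultimately show ?thesis using nn by (simp only: distrib_left)
      next
        case False
        then have "(cmod (cutoff k f x))\<^sup>2 * \<bar>r x\<bar> = 0" by (auto simp: cutoff_def)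
        then show ?thesis using nn by (simp only: distrib_left)
      qed
    qed
  qed
  moreover have "AE x in lebesgue. x \<in> UNIV - {-k..k} \<longrightarrow> cutoff k f x = 0"
    by (intro AE_I2) (simp add: cutoff_def)
  ultimately show ?thesis using k by (auto simp: L2_r0_fun_def)
qed

lemma S_cutoff: "S_fun \<alpha> (cutoff k f) x = cutoff k (S_fun \<alpha> f) x"
  by (simp add: S_fun_def cutoff_def indicator_even algebra_simps)

lemma \<Phi>_cutoff: "\<Phi> (cutoff k f) x = complex_of_real (indicator {-k..k} x) * \<Phi> f x"
  unfolding cutoff_def[abs_def] by (rule twist_mult_even) (simp add: indicator_even)

text \<open>By \<open>\<Phi>_cutoff\<close> the squared distance is the tail, outside \<open>{-k..k}\<close>, of the integral of
  \<open>(cmod (\<Phi> f x))\<^sup>2 * \<bar>r x\<bar>\<close>.\<close>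

lemma cutoff_approximates:
  assumes f: "f \<in> dom_t_fun r \<alpha>" and e: "e > 0"
  obtains k where "k > 0" "ip_dist (dom_t r \<alpha>) (t_form r \<alpha>) (ae_class r f) (ae_class r (cutoff k f)) < e"
proof -
  let ?q = "\<lambda>x. (cmod (\<Phi> f x))\<^sup>2 * \<bar>r x\<bar>"
  let ?d = "\<lambda>k x. (1 - indicator {-k..k} x) * ?q x"
  have q: "integrable lebesgue ?q" using dom_\<Phi>[OF f] by (simp add: L2_weight_def)
  then have qm: "?q \<in> borel_measurable lebesgue" by simp
  have "((\<lambda>k. LINT x|lebesgue. ?d k x) \<longlongrightarrow> (LINT x::real|lebesgue. 0)) at_top"
  proof (rule integral_dominated_convergence_at_top[where w = ?q and s = ?d and f = "\<lambda>x. 0"])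
    show "?d k \<in> borel_measurable lebesgue" for k
      by (intro borel_measurable_times borel_measurable_diff borel_measurable_const qm
          indicator_Icc_measurable_lebesgue)
    show "AE x in lebesgue. ((\<lambda>k. ?d k x) \<longlongrightarrow> 0) at_top"
    proof (intro AE_I2 tendsto_eventually)
      show "\<forall>\<^sub>F k in at_top. ?d k x = 0" for x
        using eventually_ge_at_top[of "\<bar>x\<bar>"] by eventually_elim (auto simp: indicator_def)
    qed
    show "\<forall>\<^sub>F k in at_top. AE x in lebesgue. norm (?d k x) \<le> ?q x"
      by (intro always_eventually allI AE_I2) (auto simp: indicator_def)
  qed (use q in auto)
  then have "\<forall>\<^sub>F k in at_top. (LINT x|lebesgue. ?d k x) < e\<^sup>2"
    using e by (intro order_tendstoD(2)) auto
  then have "\<forall>\<^sub>F k in at_top. (LINT x|lebesgue. ?d k x) < e\<^sup>2 \<and> 0 < k"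
    using eventually_gt_at_top[of 0] by (rule eventually_conj)
  then obtain k where k: "(LINT x|lebesgue. ?d k x) < e\<^sup>2" "0 < k"
    using eventually_happens'[OF trivial_limit_at_top_linorder] by blast
  have "(cmod (\<Phi> f x - \<Phi> (cutoff k f) x))\<^sup>2 * \<bar>r x\<bar> = ?d k x" for x
    unfolding \<Phi>_cutoff by (auto simp: indicator_def)
  then have "ip_dist (dom_t r \<alpha>) (t_form r \<alpha>) (ae_class r f) (ae_class r (cutoff k f))
      = sqrt (LINT x|lebesgue. ?d k x)"
    by (simp only: ip_dist_class[OF f L2_r0_dom[OF cutoff_L2_r0[OF f k(2)]]])
  also have "\<dots> < e" using k e by (intro real_less_lsqrt) auto
  finally show thesis using that k(2) by blast
qed

lemma carrier_L2_r0_subset: "carrier (L2_r0 r) \<subseteq> carrier (dom_t r \<alpha>)"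
  using L2_r0_dom by (auto simp: carrier_L2_r0 dom_t_eq carrier_class_space)

lemma mem_closure_by_cutoff:
  assumes f: "f \<in> dom_t_fun r \<alpha>" and A: "\<And>k. k > 0 \<Longrightarrow> ae_class r (cutoff k f) \<in> A"
  shows "ae_class r f \<in> ip_closure (dom_t r \<alpha>) (t_form r \<alpha>) A"
  unfolding form.mem_ip_closure_iff
proof (intro conjI allI impI)
  show "ae_class r f \<in> carrier (dom_t r \<alpha>)" using f by (simp add: dom_t_eq carrier_class_space)
  fix e :: real assume "e > 0"
  then obtain k where k: "k > 0"
    and d: "ip_dist (dom_t r \<alpha>) (t_form r \<alpha>) (ae_class r f) (ae_class r (cutoff k f)) < e"
    using cutoff_approximates[OF f] by metis
  have "ae_class r (cutoff k f) \<in> carrier (dom_t r \<alpha>)"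
    using L2_r0_dom[OF cutoff_L2_r0[OF f k]] by (simp add: dom_t_eq carrier_class_space)
  then show "\<exists>G\<in>A. G \<in> carrier (dom_t r \<alpha>) \<and> ip_dist (dom_t r \<alpha>) (t_form r \<alpha>) (ae_class r f) G < e"
    using A[OF k] d by blast
qed

text \<open>The cutoff interval is symmetric, so cutting off commutes with \<open>S_fun \<alpha>\<close>, and the cutoffs of a
  fixed vector are fixed. They have bounded support and approximate the vector.\<close>

lemma closure_M_plus: "ip_closure (dom_t r \<alpha>) (t_form r \<alpha>) (M_plus r \<alpha>) = sym.fixed"
proof
  show "ip_closure (dom_t r \<alpha>) (t_form r \<alpha>) (M_plus r \<alpha>) \<subseteq> sym.fixed"
    using carrier_L2_r0_subset
    by (intro sym.closure_subset_fixed) (auto simp: M_plus_eq sym.fixed_def)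
  show "sym.fixed \<subseteq> ip_closure (dom_t r \<alpha>) (t_form r \<alpha>) (M_plus r \<alpha>)"
  proof
    fix F assume "F \<in> sym.fixed"
    then have "F \<in> carrier (dom_t r \<alpha>)" and SF: "S_op r \<alpha> F = F"
      by (auto simp: sym.fixed_def)
    then obtain f where f: "f \<in> dom_t_fun r \<alpha>" "F = ae_class r f"
      by (auto simp: carrier_class_space dom_t_eq)
    have eq: "r_eq r (S_fun \<alpha> f) f"
      using SF f S_dom[OF f(1)] by (simp add: S_op_class dom_measurable dom.class_eq_iff)
    have "ae_class r (cutoff k f) \<in> M_plus r \<alpha>" if "k > 0" for k
    proof -
      note t = cutoff_L2_r0[OF f(1) that]
      have "r_eq r (S_fun \<alpha> (cutoff k f)) (cutoff k f)"
        using eq unfolding r_eq_def S_cutoff by eventually_elim (simp add: cutoff_def)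
      then show ?thesis
        using t L2_r0_dom[OF t]
        by (simp add: M_plus_eq carrier_L2_r0 S_op_class dom_measurable dom.class_eq_iff S_dom)
    qed
    then show "F \<in> ip_closure (dom_t r \<alpha>) (t_form r \<alpha>) (M_plus r \<alpha>)"
      unfolding f(2) by (rule mem_closure_by_cutoff[OF f(1)])
  qed
qed

lemma closure_M_minus: "ip_closure (dom_t r \<alpha>) (t_form r \<alpha>) (M_minus r \<alpha>) = sym.antifixed"
proof
  show "ip_closure (dom_t r \<alpha>) (t_form r \<alpha>) (M_minus r \<alpha>) \<subseteq> sym.antifixed"
    using carrier_L2_r0_subset
    by (intro sym.closure_subset_antifixed) (auto simp: M_minus_eq sym.antifixed_def)
  show "sym.antifixed \<subseteq> ip_closure (dom_t r \<alpha>) (t_form r \<alpha>) (M_minus r \<alpha>)"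
  proof
    fix F assume "F \<in> sym.antifixed"
    then have "F \<in> carrier (dom_t r \<alpha>)" and SF: "S_op r \<alpha> F = \<ominus>\<^bsub>dom_t r \<alpha>\<^esub> F"
      by (auto simp: sym.antifixed_def)
    then obtain f where f: "f \<in> dom_t_fun r \<alpha>" "F = ae_class r f"
      by (auto simp: carrier_class_space dom_t_eq)
    have eq: "r_eq r (S_fun \<alpha> f) (\<lambda>x. - f x)"
      using SF f S_dom[OF f(1)]
      by (simp add: S_op_class dom_measurable dom.class_eq_iff dom_t_eq dom.class_uminus dom.D_uminus)
    have "ae_class r (cutoff k f) \<in> M_minus r \<alpha>" if "k > 0" for k
    proof -
      note t = cutoff_L2_r0[OF f(1) that]
      have "r_eq r (S_fun \<alpha> (cutoff k f)) (\<lambda>x. - cutoff k f x)"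
        using eq unfolding r_eq_def S_cutoff by eventually_elim (simp add: cutoff_def)
      then show ?thesis
        using t L2_r0_dom[OF t]
        by (simp add: M_minus_eq carrier_L2_r0 S_op_class dom_measurable dom.class_eq_iff S_dom
            dom_t_eq dom.class_uminus dom.D_uminus)
    qed
    then show "F \<in> ip_closure (dom_t r \<alpha>) (t_form r \<alpha>) (M_minus r \<alpha>)"
      unfolding f(2) by (rule mem_closure_by_cutoff[OF f(1)])
  qed
qed

end

theorem proposition6p8:
  fixes r :: "real \<Rightarrow> real" and \<epsilon> \<alpha> :: real
  assumes "locally_integrable r"
    and "AE x in lebesgue. r (- x) = - r x"
    and "\<epsilon> > 0"
    and "AE x in lebesgue. x \<in> {-\<epsilon>..\<epsilon>} \<longrightarrow> r x = 0"
    and "AE x in lebesgue. x \<in> {..<-\<epsilon>} \<union> {\<epsilon><..} \<longrightarrow> x * r x > 0"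
    and "\<alpha> \<in> {0..2}"
  shows
    "(\<forall>f\<in>dom_t_fun r \<alpha>. \<forall>g\<in>dom_t_fun r \<alpha>.
        (\<forall>k>0. set_integrable lebesgue {-k..k} (\<lambda>x. f x * cnj (g x) * complex_of_real (r x))) \<and>
        ((\<lambda>k. LINT x:{-k..k}|lebesgue. f x * cnj (g x) * complex_of_real (r x))
           \<longlongrightarrow> t_indef_fun r f g) at_top) \<and>
     krein_space (dom_t r \<alpha>) (t_indef r) \<and>
     fundamental_decomposition (dom_t r \<alpha>) (t_indef r)
       (ip_closure (dom_t r \<alpha>) (t_form r \<alpha>) (M_plus r \<alpha>))
       (ip_closure (dom_t r \<alpha>) (t_form r \<alpha>) (M_minus r \<alpha>)) \<and>
     (\<forall>F\<in>carrier (dom_t r \<alpha>). \<forall>G\<in>carrier (dom_t r \<alpha>).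
        t_form r \<alpha> F G =
        t_indef r
          (fundamental_symmetry (dom_t r \<alpha>)
             (ip_closure (dom_t r \<alpha>) (t_form r \<alpha>) (M_plus r \<alpha>))
             (ip_closure (dom_t r \<alpha>) (t_form r \<alpha>) (M_minus r \<alpha>)) F) G)"
proof -
  interpret odd_weight r \<epsilon> \<alpha> by (rule odd_weight.intro) (fact assms)+
  show ?thesis
    unfolding closure_M_plus closure_M_minus
  proof (intro conjI ballI allI impI)
    fix f g assume fg: "f \<in> dom_t_fun r \<alpha>" "g \<in> dom_t_fun r \<alpha>"
    show "set_integrable lebesgue {-k..k} (\<lambda>x. f x * cnj (g x) * complex_of_real (r x))" for k
      by (rule set_integrable_product[OF fg])
    show "((\<lambda>k. LINT x:{-k..k}|lebesgue. f x * cnj (g x) * complex_of_real (r x))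
        \<longlongrightarrow> t_indef_fun r f g) at_top"
      unfolding t_indef_fun_eq[OF fg] by (rule tendsto_truncated_integral[OF fg])
  next
    show "krein_space (dom_t r \<alpha>) (t_indef r)"
      by (rule sym.krein_space_fixed[OF complete_dom t_indef_eq])
    show "fundamental_decomposition (dom_t r \<alpha>) (t_indef r) sym.fixed sym.antifixed"
      by (rule sym.fundamental_decomposition_fixed[OF complete_dom t_indef_eq])
    fix F G assume FG: "F \<in> carrier (dom_t r \<alpha>)" "G \<in> carrier (dom_t r \<alpha>)"
    then show "t_form r \<alpha> F G = t_indef r (fundamental_symmetry (dom_t r \<alpha>) sym.fixed sym.antifixed F) G"
      by (simp add: sym.fundamental_symmetry_eq t_indef_eq)
  qed
qed

end
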